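(* Let $\Gamma$ be a finite triangle-free unpinched graph, and let $r = |V(\Gamma)|$. Let $A(\Gamma)$ be the associated right-angled Artin group, equipped with the word metric with respect to the standard generating set. Let $\mathcal{A}$ be the family of $r$-neighborhoods of left cosets of the parabolic subgroups $\langle C \rangle$ where $C$ is an induced cycle in $\Gamma$, and let $\mathcal{B}$ be the family of left cosets of the parabolic subgroups $\langle a,b \rangle$ where $a,b$ are two non-adjacent distinct vertices of $\Gamma$. Then $A(\Gamma)$ is $(\mathcal{A},\mathcal{B})$-thick.
   Context: Graphs are simple. A graph is unpinched if it is neither complete nor separated by a clique (i.e. there is no complete subgraph $C$, possibly empty, such that removing $C$ leaves a disconnected graph). $A(\Gamma)$ is generated by $V(\Gamma)$ (the standard generating set), with the relations that two generators commute whenever the vertices are adjacent. A parabolic subgroup here is the subgroup generated by the vertices of an induced subgraph. Thickness. Given two collections $\mathcal{A},\mathcal{B}$ of subspaces of a metric space $X$, a subset $E \subseteq X$ is $(\mathcal{A},\mathcal{B})$-thick if, for all $x,y \in E$, there exist $A_1,\ldots,A_n \in \mathcal{A}$ such that $x \in A_1$, $y \in A_n$, and $A_i \cap A_{i+1}$ contains some $B \in \mathcal{B}$ for every $1 \leq i \leq n-1$. The $r$-neighborhood of $A \subseteq X$ is $\{x \in X \mid d(x,A) \leq r\}$. *)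

theory Defs
  imports
    Complex_Main
    "HOL-Algebra.Generated_Groups"
    "HOL-Algebra.Left_Coset"
    "Graph_Theory.Graph_Theory"
begin

section \<open>Graphs\<close>

text \<open>
  Finite simple graphs are the library's \<open>pair_graph\<close>s: every edge is present as two
  opposite arcs, so \<open>u\<close> and \<open>v\<close> are adjacent iff \<open>(u, v) \<in> parcs \<Gamma>\<close>.
\<close>

definition triangle_free :: "'v pair_pre_digraph \<Rightarrow> bool" where
  "triangle_free \<Gamma> \<longleftrightarrow>
     \<not> (\<exists>u v w. (u, v) \<in> parcs \<Gamma> \<and> (v, w) \<in> parcs \<Gamma> \<and> (u, w) \<in> parcs \<Gamma>)"

definition complete_graph :: "('v, 'e) pre_digraph \<Rightarrow> bool" where
  "complete_graph \<Gamma> \<longleftrightarrow> K\<^bsub>card (verts \<Gamma>)\<^esub> \<Gamma>"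

definition clique :: "'v pair_pre_digraph \<Rightarrow> 'v set \<Rightarrow> bool" where
  "clique \<Gamma> C \<longleftrightarrow> C \<subseteq> pverts \<Gamma> \<and> complete_graph (with_proj \<Gamma> \<restriction> C)"

text \<open>
  The empty set is a clique and the empty graph is complete. The library's \<open>connected\<close>
  is false for the graph without vertices; this does not matter below, since removing a
  clique leaves no vertices only if the graph is complete.
\<close>

definition separated_by_clique :: "'v pair_pre_digraph \<Rightarrow> bool" where
  "separated_by_clique \<Gamma> \<longleftrightarrow>
     (\<exists>C. clique \<Gamma> C \<and> \<not> connected (with_proj \<Gamma> \<restriction> (pverts \<Gamma> - C)))"

definition unpinched :: "'v pair_pre_digraph \<Rightarrow> bool" where
  "unpinched \<Gamma> \<longleftrightarrow> \<not> complete_graph (with_proj \<Gamma>) \<and> \<not> separated_by_clique \<Gamma>"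

text \<open>
  \<open>C\<close> spans an induced cycle: the subgraph induced on \<open>C\<close> is isomorphic to the cycle graph
  on \<open>{0, \<dots>, n - 1}\<close> for some \<open>n \<ge> 3\<close>.
\<close>

definition induced_cycle :: "'v pair_pre_digraph \<Rightarrow> 'v set \<Rightarrow> bool" where
  "induced_cycle \<Gamma> C \<longleftrightarrow> C \<subseteq> pverts \<Gamma> \<and>
     (\<exists>n c. 3 \<le> n \<and> bij_betw c {..<n} C \<and>
        (\<forall>i<n. \<forall>j<n. (c i, c j) \<in> parcs \<Gamma> \<longleftrightarrow> j = Suc i mod n \<or> i = Suc j mod n))"


section \<open>Group presentations and right-angled Artin groups\<close>

text \<open>The letter \<open>(s, True)\<close> stands for the generator \<open>s\<close>, and \<open>(s, False)\<close> for its inverse.\<close>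

type_synonym 's word = "('s \<times> bool) list"

definition words :: "'s set \<Rightarrow> 's word set" where
  "words S = lists (S \<times> UNIV)"

text \<open>
  A pair \<open>(l, r) \<in> R\<close> encodes the defining relation \<open>l = r\<close>; \<open>word_rel S R\<close> is the least
  congruence on the words over \<open>S\<close> that contains free cancellation and \<open>R\<close>.
\<close>

inductive_set word_rel :: "'s set \<Rightarrow> ('s word \<times> 's word) set \<Rightarrow> ('s word \<times> 's word) set"
  for S R where
  refl: "w \<in> words S \<Longrightarrow> (w, w) \<in> word_rel S R"
| sym: "(v, w) \<in> word_rel S R \<Longrightarrow> (w, v) \<in> word_rel S R"
| trans: "(u, v) \<in> word_rel S R \<Longrightarrow> (v, w) \<in> word_rel S R \<Longrightarrow> (u, w) \<in> word_rel S R"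
| cancel: "u \<in> words S \<Longrightarrow> v \<in> words S \<Longrightarrow> s \<in> S \<Longrightarrow>
    (u @ [(s, b), (s, \<not> b)] @ v, u @ v) \<in> word_rel S R"
| relator: "u \<in> words S \<Longrightarrow> v \<in> words S \<Longrightarrow> l \<in> words S \<Longrightarrow> r \<in> words S \<Longrightarrow> (l, r) \<in> R \<Longrightarrow>
    (u @ l @ v, u @ r @ v) \<in> word_rel S R"

definition presented_group ::
    "'s set \<Rightarrow> ('s word \<times> 's word) set \<Rightarrow> 's word set monoid" where
  "presented_group S R =
     \<lparr>carrier = words S // word_rel S R,
      monoid.mult = (\<lambda>X Y. \<Union>x\<in>X. \<Union>y\<in>Y. word_rel S R `` {x @ y}),
      monoid.one = word_rel S R `` {[]}\<rparr>"

definition raag_relations :: "'v pair_pre_digraph \<Rightarrow> ('v word \<times> 'v word) set" where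
  "raag_relations \<Gamma> =
     {([(u, True), (v, True)], [(v, True), (u, True)]) | u v. (u, v) \<in> parcs \<Gamma>}"

definition raag :: "'v pair_pre_digraph \<Rightarrow> 'v word set monoid" where
  "raag \<Gamma> = presented_group (pverts \<Gamma>) (raag_relations \<Gamma>)"

definition raag_gen :: "'v pair_pre_digraph \<Rightarrow> 'v \<Rightarrow> 'v word set" where
  "raag_gen \<Gamma> v = word_rel (pverts \<Gamma>) (raag_relations \<Gamma>) `` {[(v, True)]}"

definition parabolic :: "'v pair_pre_digraph \<Rightarrow> 'v set \<Rightarrow> 'v word set set" where
  "parabolic \<Gamma> U = generate (raag \<Gamma>) (raag_gen \<Gamma> ` U)"


section \<open>Word metric, neighbourhoods and thickness\<close>

definition word_length :: "('a, 'b) monoid_scheme \<Rightarrow> 'a set \<Rightarrow> 'a \<Rightarrow> nat" where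
  "word_length G S g =
     (LEAST n. \<exists>ws. length ws = n \<and> set ws \<subseteq> S \<union> m_inv G ` S \<and>
        foldr (\<otimes>\<^bsub>G\<^esub>) ws \<one>\<^bsub>G\<^esub> = g)"

definition word_metric :: "('a, 'b) monoid_scheme \<Rightarrow> 'a set \<Rightarrow> 'a \<Rightarrow> 'a \<Rightarrow> real" where
  "word_metric G S g h = real (word_length G S (inv\<^bsub>G\<^esub> g \<otimes>\<^bsub>G\<^esub> h))"

definition raag_metric :: "'v pair_pre_digraph \<Rightarrow> 'v word set \<Rightarrow> 'v word set \<Rightarrow> real" where
  "raag_metric \<Gamma> = word_metric (raag \<Gamma>) (raag_gen \<Gamma> ` pverts \<Gamma>)"

text \<open>Here \<open>(X, d)\<close> is a metric space and \<open>A\<close> a nonempty subset of \<open>X\<close>.\<close>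

definition nbhd :: "'x set \<Rightarrow> ('x \<Rightarrow> 'x \<Rightarrow> real) \<Rightarrow> real \<Rightarrow> 'x set \<Rightarrow> 'x set" where
  "nbhd X d r A = {x \<in> X. (INF a\<in>A. d x a) \<le> r}"

text \<open>\<open>thick \<A> \<B> E\<close>: the set \<open>E\<close> is \<open>(\<A>, \<B>)\<close>-thick; the metric plays no role in this notion.\<close>

definition thick :: "'x set set \<Rightarrow> 'x set set \<Rightarrow> 'x set \<Rightarrow> bool" where
  "thick \<A> \<B> E \<longleftrightarrow>
     (\<forall>x\<in>E. \<forall>y\<in>E. \<exists>n A. 1 \<le> n \<and> (\<forall>i\<in>{1..n}. A i \<in> \<A>) \<and> x \<in> A 1 \<and> y \<in> A n \<and>
        (\<forall>i::nat. 1 \<le> i \<and> i < n \<longrightarrow> (\<exists>B\<in>\<B>. B \<subseteq> A i \<inter> A (i + 1))))"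


section \<open>Basic facts\<close>

lemma words_append [simp]: "u @ v \<in> words S \<longleftrightarrow> u \<in> words S \<and> v \<in> words S"
  by (auto simp: words_def)

lemma words_Nil [simp]: "[] \<in> words S"
  by (simp add: words_def)

lemma words_Cons [simp]: "(s, b) # w \<in> words S \<longleftrightarrow> s \<in> S \<and> w \<in> words S"
  by (auto simp: words_def)

lemma word_rel_words: "(v, w) \<in> word_rel S R \<Longrightarrow> v \<in> words S \<and> w \<in> words S"
  by (induction rule: word_rel.induct) auto

lemma equiv_word_rel: "equiv (words S) (word_rel S R)"
proof (rule equivI)
  show "word_rel S R \<subseteq> words S \<times> words S"
    using word_rel_words by fast
  show "refl_on (words S) (word_rel S R)"
    by (auto simp: refl_on_def intro: word_rel.refl)
  show "sym_on UNIV (word_rel S R)"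
    by (auto simp: sym_on_def intro: word_rel.sym)
  show "trans_on UNIV (word_rel S R)"
    by (auto simp: trans_on_def intro: word_rel.trans)
qed

lemma word_rel_append_left:
  "(v, w) \<in> word_rel S R \<Longrightarrow> u \<in> words S \<Longrightarrow> (u @ v, u @ w) \<in> word_rel S R"
proof (induction rule: word_rel.induct)
  case (cancel x y s b)
  then show ?case using word_rel.cancel[of "u @ x" S y s b R] by simp
next
  case (relator x y l r)
  then show ?case using word_rel.relator[of "u @ x" S y l r R] by simp
qed (auto intro: word_rel.intros)

lemma word_rel_append_right:
  "(v, w) \<in> word_rel S R \<Longrightarrow> u \<in> words S \<Longrightarrow> (v @ u, w @ u) \<in> word_rel S R"
proof (induction rule: word_rel.induct)
  case (cancel x y s b)
  then show ?case using word_rel.cancel[of x S "y @ u" s b R] by simp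
next
  case (relator x y l r)
  then show ?case using word_rel.relator[of x S "y @ u" l r R] by simp
qed (auto intro: word_rel.intros)

lemma presented_group_mult:
  assumes "x \<in> words S" "y \<in> words S"
  shows "word_rel S R `` {x} \<otimes>\<^bsub>presented_group S R\<^esub> word_rel S R `` {y} = word_rel S R `` {x @ y}"
proof -
  have "word_rel S R `` {x' @ y'} = word_rel S R `` {x @ y}"
    if "(x, x') \<in> word_rel S R" "(y, y') \<in> word_rel S R" for x' y'
  proof -
    have "(x @ y, x' @ y') \<in> word_rel S R"
      using that assms word_rel_words
      by (meson word_rel.trans word_rel_append_left word_rel_append_right)
    then show ?thesis
      by (metis equiv_class_eq equiv_word_rel)
  qed
  then show ?thesis
    using assms by (auto simp: presented_group_def intro: word_rel.refl)
qed

lemma word_rel_inverse: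
  "w \<in> words S \<Longrightarrow> (rev (map (apsnd Not) w) @ w, []) \<in> word_rel S R"
proof (induction w)
  case Nil
  show ?case by (simp add: word_rel.refl)
next
  case (Cons a w)
  obtain s b where a: "a = (s, b)" by force
  have ws: "s \<in> S" "w \<in> words S" using Cons.prems by (auto simp: a)
  have inv: "rev (map (apsnd Not) w) \<in> words S"
    using ws by (fastforce simp: words_def)
  have "(rev (map (apsnd Not) w) @ [(s, \<not> b), (s, \<not> \<not> b)] @ w,
      rev (map (apsnd Not) w) @ w) \<in> word_rel S R"
    using ws inv by (intro word_rel.cancel)
  then show ?case
    using Cons.IH ws by (auto simp: a intro: word_rel.trans)
qed

lemma group_presented_group: "group (presented_group S R)"
proof (rule groupI)
  let ?G = "presented_group S R" and ?c = "\<lambda>w. word_rel S R `` {w}"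
  have car: "carrier ?G = ?c ` words S"
    by (auto simp: presented_group_def quotient_def)
  have one: "\<one>\<^bsub>?G\<^esub> = ?c []"
    by (simp add: presented_group_def)
  show "\<one>\<^bsub>?G\<^esub> \<in> carrier ?G"
    by (simp add: car one)
  show "x \<otimes>\<^bsub>?G\<^esub> y \<in> carrier ?G" if "x \<in> carrier ?G" "y \<in> carrier ?G" for x y
    using that by (auto simp: car presented_group_mult)
  show "x \<otimes>\<^bsub>?G\<^esub> y \<otimes>\<^bsub>?G\<^esub> z = x \<otimes>\<^bsub>?G\<^esub> (y \<otimes>\<^bsub>?G\<^esub> z)"
    if "x \<in> carrier ?G" "y \<in> carrier ?G" "z \<in> carrier ?G" for x y z
    using that by (auto simp: car presented_group_mult)
  show "\<one>\<^bsub>?G\<^esub> \<otimes>\<^bsub>?G\<^esub> x = x" if "x \<in> carrier ?G" for x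
    using that by (auto simp: car one presented_group_mult)
  show "\<exists>y\<in>carrier ?G. y \<otimes>\<^bsub>?G\<^esub> x = \<one>\<^bsub>?G\<^esub>" if x: "x \<in> carrier ?G" for x
  proof -
    obtain w where w: "x = ?c w" "w \<in> words S" using x by (auto simp: car)
    let ?w' = "rev (map (apsnd Not) w)"
    have w': "?w' \<in> words S" using w(2) by (fastforce simp: words_def)
    have "?c ?w' \<otimes>\<^bsub>?G\<^esub> x = \<one>\<^bsub>?G\<^esub>"
      using w w' word_rel_inverse[OF w(2)]
      by (metis equiv_class_eq equiv_word_rel one presented_group_mult)
    then show ?thesis using w' car by blast
  qed
qed

lemma group_raag: "group (raag \<Gamma>)"
  by (simp add: raag_def group_presented_group)

end

theory Submission
  imports Defs
begin

text \<open>
  Call two induced cycles linked if they share two non-adjacent vertices \<open>a\<close>, \<open>d\<close>. For every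
  group element \<open>g\<close> the cosets of the parabolic subgroups of two linked cycles at \<open>g\<close> both contain
  the coset \<open>g\<langle>a, d\<rangle>\<close>, so their neighbourhoods are consecutive in a chain. Moreover
  \<open>g\<langle>C\<rangle> = gs\<langle>C\<rangle>\<close> whenever the generator \<open>s\<close> lies on \<open>C\<close>. Suppose that every
  vertex \<open>v\<close> lies on an induced cycle \<open>c v\<close> and that these cycles are connected by
  chains of linked induced cycles. Then one moves from \<open>g\<close> to \<open>gs\<close> by passing, at \<open>g\<close>, from any
  chosen cycle to \<open>c s\<close>, and spelling a group element letter by letter joins any two points. This
  reduces the claim to the existence of \<open>c\<close> (\<open>linked_cycles_cover\<close>), which is pure graph theory.

  It is convenient to speak of non-adjacent pairs instead of cycles: two pairs are equivalent
  if a chain of pairs joins them in which consecutive pairs lie on a common induced cycle. Fix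
  a vertex \<open>b\<close>. Its neighbours are pairwise non-adjacent, because there are no triangles. Let \<open>D\<close>
  be a component of the graph induced on the vertices at distance at least two from \<open>b\<close>. Any two
  neighbours of \<open>b\<close> that touch \<open>D\<close> (a pair of spokes) lie on an induced cycle through \<open>b\<close> and
  \<open>D\<close>. All pairs of spokes are equivalent, in three stages:

  \<^item> For one component, a minimal connected set that touches three spokes \<open>a\<close>, \<open>d\<close>, \<open>e\<close> has
    vertices \<open>x\<close> that every path from one of the spokes must use; the pair \<open>b, x\<close> then lies on
    several of the three cycles (\<open>spokes_equiv_three\<close>).

  \<^item> For two components at the same \<open>b\<close>: since no vertex and no edge separates the graph, the
    components can be connected around \<open>b\<close>, and closing up a minimal connection at a spoke that they
    share gives an induced cycle that avoids \<open>b\<close> and contains a pair of spokes of each of them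
    (\<open>spokes_equiv_linked\<close>, \<open>spokes_equiv_vertex\<close>).

  \<^item> For adjacent \<open>b\<close> and \<open>b'\<close>, an induced cycle through the edge contains a pair of spokes of both
    (\<open>spokes_equiv_edge\<close>).

  All cycles are produced by one lemma (\<open>induced_cycle_theta\<close>): two non-adjacent vertices that are
  joined through two disjoint connected sets without edges between them lie on an induced cycle.
\<close>

section \<open>Connected vertex sets\<close>

context pair_graph
begin

abbreviation adj :: "'a \<Rightarrow> 'a \<Rightarrow> bool" where
  "adj u v \<equiv> (u, v) \<in> parcs G"

lemma adj_sym: "adj u v \<longleftrightarrow> adj v u"
  using arcs_symmetric by blast

lemma adj_irrefl [simp]: "\<not> adj u u"
  using no_loops' by blast

lemma adj_verts: "adj u v \<Longrightarrow> u \<in> pverts G \<and> v \<in> pverts G"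
  using wellformed' by blast

definition touches :: "'a set \<Rightarrow> 'a set \<Rightarrow> bool" where
  "touches X Y \<longleftrightarrow> (\<exists>x\<in>X. \<exists>y\<in>Y. adj x y)"

lemma touches_sym: "touches X Y \<longleftrightarrow> touches Y X"
  unfolding touches_def using adj_sym by blast

lemma touches_mono: "touches X Y \<Longrightarrow> X \<subseteq> X' \<Longrightarrow> Y \<subseteq> Y' \<Longrightarrow> touches X' Y'"
  unfolding touches_def by blast

text \<open>
  Connectedness of the induced subgraph, expressed by the absence of an empty cut: in this
  form no walks are needed to combine connected sets or to find an edge leaving a subset.
\<close>

definition conn :: "'a set \<Rightarrow> bool" where
  "conn D \<longleftrightarrow> D \<noteq> {} \<and> (\<forall>U. U \<noteq> {} \<and> U \<subset> D \<longrightarrow> touches U (D - U))"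

lemma conn_nonempty: "conn D \<Longrightarrow> D \<noteq> {}"
  by (simp add: conn_def)

lemma conn_singleton [simp]: "conn {x}"
  by (auto simp: conn_def)

lemma conn_touches: "conn D \<Longrightarrow> U \<subseteq> D \<Longrightarrow> U \<noteq> {} \<Longrightarrow> U \<noteq> D \<Longrightarrow> touches U (D - U)"
  by (simp add: conn_def psubset_eq)

lemma conn_cut: "conn D \<Longrightarrow> U \<subseteq> D \<Longrightarrow> U \<noteq> {} \<Longrightarrow> U \<noteq> D \<Longrightarrow> \<exists>u\<in>U. \<exists>v\<in>D - U. adj u v"
  using conn_touches unfolding touches_def .

lemma conn_Un:
  assumes A: "conn A" and B: "conn B" and AB: "touches A B"
  shows "conn (A \<union> B)"
proof -
  have "touches U (A \<union> B - U)" if U: "U \<noteq> {}" "U \<subset> A \<union> B" for U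
  proof -
    have "U = (U \<inter> A) \<union> (U \<inter> B)" using U by blast
    then consider "U \<inter> A \<noteq> {}" "U \<inter> A \<noteq> A" | "U \<inter> B \<noteq> {}" "U \<inter> B \<noteq> B"
      | "U = A" | "U = B"
      using U by (metis psubsetE sup_bot.left_neutral sup_bot.right_neutral)
    then show ?thesis
    proof cases
      case 1
      then have "touches (U \<inter> A) (A - U \<inter> A)" using conn_touches[OF A] by blast
      then show ?thesis by (rule touches_mono) auto
    next
      case 2
      then have "touches (U \<inter> B) (B - U \<inter> B)" using conn_touches[OF B] by blast
      then show ?thesis by (rule touches_mono) auto
    next
      case 3
      show ?thesis
      proof (cases "U \<inter> B = {}")
        case True
        then show ?thesis using AB 3 by (auto simp: touches_def)
      next
        case False
        then have "touches (U \<inter> B) (B - U \<inter> B)" using conn_touches[OF B] U 3 by blast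
        then show ?thesis by (rule touches_mono) auto
      qed
    next
      case 4
      show ?thesis
      proof (cases "U \<inter> A = {}")
        case True
        then show ?thesis using AB 4 touches_sym[of A B] by (auto simp: touches_def)
      next
        case False
        then have "touches (U \<inter> A) (A - U \<inter> A)" using conn_touches[OF A] U 4 by blast
        then show ?thesis by (rule touches_mono) auto
      qed
    qed
  qed
  then show ?thesis using conn_nonempty[OF A] by (auto simp: conn_def)
qed

lemma conn_insert: "conn D \<Longrightarrow> touches {x} D \<Longrightarrow> conn (insert x D)"
  using conn_Un[of "{x}" D] by simp

lemma conn_touches_rest: "conn D \<Longrightarrow> x \<in> D \<Longrightarrow> D \<noteq> {x} \<Longrightarrow> touches {x} (D - {x})"
  using conn_cut[of D "{x}"] by (auto simp: touches_def)

text \<open>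
  A largest connected proper subset that contains \<open>y\<close> can be extended by one neighbouring
  vertex and stays connected, so it misses exactly one vertex.
\<close>

lemma non_cut_vertex:
  assumes D: "finite D" "conn D" and y: "y \<in> D" "D \<noteq> {y}"
  shows "\<exists>x\<in>D. x \<noteq> y \<and> conn (D - {x})"
proof -
  let ?P = "\<lambda>S. conn S \<and> y \<in> S \<and> S \<subset> D"
  have "?P {y}" using y by auto
  then obtain S where S: "?P S" and max: "\<And>S'. ?P S' \<Longrightarrow> card S' \<le> card S"
    using ex_has_greatest_nat[of ?P "{y}" card "card D"] D(1)
    by (metis psubset_card_mono)
  obtain u x where ux: "u \<in> S" "x \<in> D - S" "adj u x"
    using conn_cut[OF D(2)] S by blast
  have "conn (insert x S)"
    using S ux conn_insert touches_sym[of "{x}" S] by (auto simp: touches_def)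
  moreover have "card (insert x S) > card S"
    using ux S D(1) by (metis DiffD2 card_insert_disjoint finite_subset lessI psubset_imp_subset)
  ultimately have "insert x S = D" using max[of "insert x S"] S ux by force
  then have "S = D - {x}" using ux by auto
  then show ?thesis using S ux by auto
qed

text \<open>
  A minimal connected set that touches all members of a family of terminals. Deleting a
  vertex that does not disconnect it must lose some terminal, so that vertex is the only
  contact with this terminal; unless the set is a singleton, there are two such vertices,
  and they belong to different terminals.
\<close>

lemma minimal_touching:
  assumes D: "finite D" "conn D" and F: "\<And>X. X \<in> F \<Longrightarrow> touches X D"
  obtains T x where "T \<subseteq> D" "T = {x}" "\<And>X. X \<in> F \<Longrightarrow> touches X T"
  | T X Y x y where "T \<subseteq> D" "conn T" "\<And>X. X \<in> F \<Longrightarrow> touches X T"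
      "X \<in> F" "Y \<in> F" "X \<noteq> Y" "x \<in> T" "y \<in> T" "x \<noteq> y" "conn (T - {x})" "conn (T - {y})"
      "\<not> touches X (T - {x})" "\<not> touches Y (T - {y})"
proof -
  let ?P = "\<lambda>T. T \<subseteq> D \<and> conn T \<and> (\<forall>X\<in>F. touches X T)"
  obtain T where T: "?P T" and min: "\<And>T'. ?P T' \<Longrightarrow> card T \<le> card T'"
    using ex_has_least_nat[of ?P D card] D F by auto
  have fin: "finite T" using T D finite_subset by blast
  obtain y0 where y0: "y0 \<in> T" using T conn_nonempty by blast
  show thesis
  proof (cases "T = {y0}")
    case True
    then show thesis using that(1) T by blast
  next
    case False
    obtain x where x: "x \<in> T" "x \<noteq> y0" "conn (T - {x})"
      using non_cut_vertex[OF fin _ y0 False] T by auto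
    obtain y where y: "y \<in> T" "y \<noteq> x" "conn (T - {y})"
      using non_cut_vertex[OF fin _ x(1)] T x y0 by blast
    have sole: "\<exists>X\<in>F. \<not> touches X (T - {z})" if z: "z \<in> T" "conn (T - {z})" for z
      using min[of "T - {z}"] T z fin card_Diff1_less[of T z] by fastforce
    obtain X where X: "X \<in> F" "\<not> touches X (T - {x})" using sole x by blast
    obtain Y where Y: "Y \<in> F" "\<not> touches Y (T - {y})" using sole y by blast
    have "X \<noteq> Y"
    proof
      assume "X = Y"
      then have "\<not> touches X T" using X Y y unfolding touches_def by blast
      then show False using X T by blast
    qed
    then show thesis using that(2)[of T X Y x y] T X Y x y by blast
  qed
qed

text \<open>
  Consider the union of \<open>X\<close> with all connected subsets of \<open>K\<close> that avoid \<open>X\<close> and \<open>Y\<close> and touch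
  \<open>X\<close>. If none of them touched \<open>Y\<close>, this union would have no edge to the rest of \<open>K\<close>.
\<close>

lemma conn_set_between:
  assumes K: "conn K" and XY: "X \<subseteq> K" "Y \<subseteq> K" "X \<noteq> {}" "Y \<noteq> {}" "X \<inter> Y = {}" "\<not> touches X Y"
  shows "\<exists>W \<subseteq> K - X - Y. conn W \<and> touches X W \<and> touches Y W"
proof (rule ccontr)
  assume none: "\<not> ?thesis"
  define S where "S = {W. W \<subseteq> K - X - Y \<and> conn W \<and> touches X W}"
  define U where "U = X \<union> \<Union> S"
  have "\<Union> S \<subseteq> K - X - Y" unfolding S_def by (rule Union_least) simp
  then have UY: "U \<inter> Y = {}" and UK: "U \<subseteq> K" using XY(1,5) by (auto simp: U_def)
  have U: "U \<noteq> {}" "U \<noteq> K" using XY(2,3,4) UY by (auto simp: U_def)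
  obtain u v where uv: "u \<in> U" "v \<in> K" "v \<notin> U" "adj u v"
    using conn_cut[OF K UK U] by blast
  have vY: "v \<notin> Y"
  proof
    assume v: "v \<in> Y"
    from uv(1) show False unfolding U_def
    proof
      assume "u \<in> X"
      then show False using v uv(4) XY(6) by (auto simp: touches_def)
    next
      assume "u \<in> \<Union> S"
      then obtain W where W: "W \<in> S" "u \<in> W" by blast
      then have "touches Y W" using v uv(4) adj_sym[of u v] by (auto simp: touches_def)
      then show False using W(1) none by (auto simp: S_def)
    qed
  qed
  have vR: "v \<in> K - X - Y" using uv vY by (auto simp: U_def)
  from uv(1) have "\<exists>W\<in>S. v \<in> W" unfolding U_def
  proof
    assume "u \<in> X"
    then have "{v} \<in> S" using uv vR by (auto simp: S_def touches_def)
    then show ?thesis by blast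
  next
    assume "u \<in> \<Union> S"
    then obtain W where W: "W \<in> S" "u \<in> W" by blast
    have "touches {v} W" using W(2) uv(4) adj_sym[of u v] by (auto simp: touches_def)
    then have "conn (insert v W)" using conn_insert W(1) by (simp add: S_def)
    moreover have "touches X (insert v W)"
      using W(1) touches_mono[of X W X "insert v W"] by (auto simp: S_def)
    ultimately have "insert v W \<in> S" using W(1) vR by (auto simp: S_def)
    then show ?thesis by blast
  qed
  then show False using uv(3) by (auto simp: U_def)
qed

section \<open>Induced paths and induced cycles\<close>

fun ind_path :: "'a list \<Rightarrow> bool" where
  "ind_path [] = False"
| "ind_path [x] = True"
| "ind_path (x # y # zs) \<longleftrightarrow>
     adj x y \<and> x \<notin> set (y # zs) \<and> (\<forall>z\<in>set zs. \<not> adj x z) \<and> ind_path (y # zs)"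

lemma ind_path_tl: "ind_path (x # xs) \<Longrightarrow> xs \<noteq> [] \<Longrightarrow> ind_path xs"
  by (cases xs) auto

lemma ind_path_butlast: "ind_path (xs @ [y]) \<Longrightarrow> xs \<noteq> [] \<Longrightarrow> ind_path xs"
proof (induction xs)
  case (Cons x xs)
  then show ?case by (cases xs) auto
qed simp

lemma ind_path_last: "ind_path (zs @ [y, a]) \<Longrightarrow> adj y a \<and> (\<forall>z\<in>set zs. \<not> adj z a)"
proof (induction zs)
  case (Cons z zs)
  then show ?case by (cases zs) auto
qed simp

lemma ind_path_conn: "ind_path xs \<Longrightarrow> conn (set xs)"
proof (induction xs rule: ind_path.induct)
  case (3 x y zs)
  then have "conn (insert x (set (y # zs)))"
    by (intro conn_insert) (auto simp: touches_def)
  then show ?case by simp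
qed auto

lemma ind_path_nth:
  "ind_path xs \<Longrightarrow> distinct xs \<and>
     (\<forall>i<length xs. \<forall>j<length xs. adj (xs ! i) (xs ! j) \<longleftrightarrow> j = Suc i \<or> i = Suc j)"
proof (induction xs rule: ind_path.induct)
  case (3 x y zs)
  have first: "adj x ((y # zs) ! j) \<longleftrightarrow> j = 0" if "j < length (y # zs)" for j
    using 3(2) that by (cases j) auto
  show ?case
  proof (intro conjI allI impI)
    show "distinct (x # y # zs)" using 3 by auto
  next
    fix i j
    assume "i < length (x # y # zs)" "j < length (x # y # zs)"
    then show "adj ((x # y # zs) ! i) ((x # y # zs) ! j) \<longleftrightarrow> j = Suc i \<or> i = Suc j"
      using 3 first adj_sym[of x] by (cases i; cases j) auto
  qed
qed auto

lemma ind_path_append: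
  "ind_path (us @ [d]) \<Longrightarrow> ind_path (d # vs) \<Longrightarrow> set us \<inter> set vs = {} \<Longrightarrow>
     \<not> touches (set us) (set vs) \<Longrightarrow> ind_path (us @ d # vs)"
proof (induction us)
  case (Cons u us)
  then show ?case by (cases us) (auto simp: touches_def)
qed simp

text \<open>
  Unless it is a single vertex, a minimal connected set that touches \<open>a\<close> and \<open>d\<close> contains
  exactly one neighbour \<open>x\<close> of \<open>a\<close>, and stays connected without \<open>x\<close>. An induced path from \<open>x\<close>
  to \<open>d\<close> through the rest, preceded by \<open>a\<close>, is again induced.
\<close>

lemma ind_path_through:
  assumes "finite D" "conn D" "a \<noteq> d" "\<not> adj a d" "a \<notin> D" "d \<notin> D"
    and "touches {a} D" "touches {d} D"
  shows "\<exists>xs. xs \<noteq> [] \<and> set xs \<subseteq> D \<and> ind_path (a # xs @ [d])"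
  using assms
proof (induction "card D" arbitrary: D a rule: less_induct)
  case less
  show ?case
  proof (rule minimal_touching[of D "{{a}, {d}}"])
    show "finite D" "conn D" by fact+
    show "touches X D" if "X \<in> {{a}, {d}}" for X using that less.prems by blast
  next
    fix T x
    assume T: "T \<subseteq> D" "T = {x}" "\<And>X. X \<in> {{a}, {d}} \<Longrightarrow> touches X T"
    then have "adj a x" "adj x d" using adj_sym by (auto simp: touches_def)
    then have "ind_path (a # [x] @ [d])" using T less.prems by auto
    then show ?thesis using T by (intro exI[of _ "[x]"]) auto
  next
    fix T X Y x' y'
    assume T: "T \<subseteq> D" "conn T" "\<And>X. X \<in> {{a}, {d}} \<Longrightarrow> touches X T"
      and XY: "X \<in> {{a}, {d}}" "Y \<in> {{a}, {d}}" "X \<noteq> Y" "x' \<in> T" "y' \<in> T" "x' \<noteq> y'"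
        "conn (T - {x'})" "conn (T - {y'})" "\<not> touches X (T - {x'})" "\<not> touches Y (T - {y'})"
    obtain x y where xy: "x \<in> T" "y \<in> T" "x \<noteq> y" "conn (T - {x})"
      "\<not> touches {a} (T - {x})" "\<not> touches {d} (T - {y})"
    proof (cases "X = {a}")
      case True
      then have "Y = {d}" using XY by blast
      then show thesis using that[of x' y'] True XY by blast
    next
      case False
      then have "X = {d}" "Y = {a}" using XY by blast+
      then show thesis using that[of y' x'] XY by blast
    qed
    have ax: "adj a x" using T(3)[of "{a}"] xy(5) by (auto simp: touches_def)
    have dy: "adj d y" using T(3)[of "{d}"] xy(6) by (auto simp: touches_def)
    have "card (T - {x}) < card D"
      using T xy less.prems(1) by (metis card_Diff1_less card_mono finite_subset order_less_le_trans)
    moreover have "finite (T - {x})" using T less.prems(1) finite_subset by blast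
    moreover have "\<not> adj x d" using xy adj_sym by (auto simp: touches_def)
    moreover have "x \<noteq> d" "d \<notin> T - {x}" using xy T less.prems by auto
    moreover have "touches {x} (T - {x})" using conn_touches_rest[of T x] T xy by blast
    moreover have "touches {d} (T - {x})" using dy xy by (auto simp: touches_def)
    ultimately obtain xs where xs: "xs \<noteq> []" "set xs \<subseteq> T - {x}" "ind_path (x # xs @ [d])"
      using less.hyps[of "T - {x}" x] xy(4) by blast
    have "ind_path (a # (x # xs) @ [d])"
      using xs ax xy T less.prems by (auto simp: touches_def)
    then show ?thesis using xs xy T by (intro exI[of _ "x # xs"]) auto
  qed
qed

lemma induced_cycle_close:
  assumes p: "ind_path (x # zs @ [y])" "set (x # zs @ [y]) \<subseteq> pverts G"
    and b: "b \<in> pverts G" "b \<notin> set (x # zs @ [y])" "adj b x" "adj b y" "\<And>z. z \<in> set zs \<Longrightarrow> \<not> adj b z"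
  shows "induced_cycle G (insert b (set (x # zs @ [y])))"
proof -
  let ?p = "x # zs @ [y]" and ?n = "Suc (length (x # zs @ [y]))"
  let ?c = "\<lambda>i. (b # ?p) ! i"
  have n: "?n = length zs + 3" by simp
  have p': "distinct ?p" "\<And>i j. i < length ?p \<Longrightarrow> j < length ?p \<Longrightarrow>
      adj (?p ! i) (?p ! j) \<longleftrightarrow> j = Suc i \<or> i = Suc j"
    using ind_path_nth[OF p(1)] by blast+
  have "distinct (b # ?p)" using p'(1) b(2) by simp
  then have bij: "bij_betw ?c {..<?n} (insert b (set ?p))"
    using bij_betw_nth[of "b # ?p" "{..<?n}" "insert b (set ?p)"] by simp
  have first: "adj b (?p ! j) \<longleftrightarrow> j = 0 \<or> Suc j = length ?p" if j: "j < length ?p" for j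
  proof (cases j)
    case 0
    then show ?thesis using b by simp
  next
    case (Suc k)
    then show ?thesis
      using j b by (auto simp: nth_append split: if_splits dest: less_SucI)
  qed
  have "adj (?c i) (?c j) \<longleftrightarrow> j = Suc i mod ?n \<or> i = Suc j mod ?n" if ij: "i < ?n" "j < ?n" for i j
  proof -
    have mod: "Suc k mod ?n = (if Suc k = ?n then 0 else Suc k)" if "k < ?n" for k
      using that by (simp only: mod_Suc mod_less)
    show ?thesis
    proof (cases i)
      case 0
      show ?thesis
      proof (cases j)
        case 0
        then show ?thesis using \<open>i = 0\<close> n by simp
      next
        case (Suc l)
        then have "adj (?c i) (?c j) \<longleftrightarrow> l = 0 \<or> Suc l = length ?p"
          using first[of l] ij \<open>i = 0\<close> by simp
        then show ?thesis unfolding mod[OF ij(1)] mod[OF ij(2)] using ij Suc \<open>i = 0\<close> n by auto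
      qed
    next
      case (Suc k)
      show ?thesis
      proof (cases j)
        case 0
        have "adj (?c i) (?c j) \<longleftrightarrow> k = 0 \<or> Suc k = length ?p"
          using first[of k] ij Suc 0 adj_sym[of b] by simp
        then show ?thesis unfolding mod[OF ij(1)] mod[OF ij(2)] using ij Suc 0 n by auto
      next
        case (Suc l)
        have "adj (?c i) (?c j) \<longleftrightarrow> l = Suc k \<or> k = Suc l"
          using p'(2)[of k l] ij Suc \<open>i = Suc k\<close> by simp
        then show ?thesis unfolding mod[OF ij(1)] mod[OF ij(2)] using ij Suc \<open>i = Suc k\<close> by auto
      qed
    qed
  qed
  moreover have "3 \<le> ?n" using n by simp
  moreover have "insert b (set ?p) \<subseteq> pverts G" using p(2) b(1) by simp
  ultimately show ?thesis unfolding induced_cycle_def using bij by blast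
qed

text \<open>
  Two induced paths between \<open>a\<close> and \<open>d\<close>, one through each set, have no chord between them.
  Both arcs of the cycle are connected and reach from \<open>a\<close> to \<open>d\<close>; this is what shows later
  that the cycle has to pass through a bottleneck.
\<close>

lemma induced_cycle_theta:
  assumes D: "D \<subseteq> pverts G" "conn D" "touches {a} D" "touches {d} D"
    and E: "E \<subseteq> pverts G" "conn E" "touches {a} E" "touches {d} E"
    and DE: "D \<inter> E = {}" "\<not> touches D E"
    and ad: "a \<noteq> d" "\<not> adj a d" "a \<notin> D \<union> E" "d \<notin> D \<union> E"
  obtains C where "induced_cycle G C" "a \<in> C" "d \<in> C" "C \<subseteq> {a, d} \<union> D \<union> E"
    "conn (C \<inter> D)" "touches {a} (C \<inter> D)" "touches {d} (C \<inter> D)"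
    "conn (C \<inter> E)" "touches {a} (C \<inter> E)" "touches {d} (C \<inter> E)"
proof -
  have fin: "finite D" "finite E" using D E pair_finite_verts finite_subset by blast+
  obtain xs where xs: "xs \<noteq> []" "set xs \<subseteq> D" "ind_path (a # xs @ [d])"
    using ind_path_through[of D a d] fin D ad by blast
  obtain ys where ys: "ys \<noteq> []" "set ys \<subseteq> E" "ind_path (d # ys @ [a])"
    using ind_path_through[of E d a] fin E ad adj_sym[of a d] by blast
  obtain x xs' where x: "xs = x # xs'" using xs by (cases xs) auto
  obtain y ys' where y: "ys = ys' @ [y]" using ys by (cases ys rule: rev_cases) auto
  have p1: "ind_path (xs @ [d])" using ind_path_tl[OF xs(3)] by simp
  have p2: "ind_path (d # ys)" using ind_path_butlast[of "d # ys" a] ys(3) by simp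
  have "ind_path (xs @ d # ys)"
    using ind_path_append[OF p1 p2] xs ys DE touches_mono by blast
  then have path: "ind_path (x # (xs' @ d # ys') @ [y])" by (simp add: x y)
  have end_a: "adj y a \<and> (\<forall>z\<in>set (d # ys'). \<not> adj z a)"
    using ind_path_last[of "d # ys'" y a] ys(3) by (simp add: y)
  have start_a: "adj a x" "\<And>z. z \<in> set xs' \<Longrightarrow> \<not> adj a z" using xs(3) by (auto simp: x)
  let ?C = "insert a (set (x # (xs' @ d # ys') @ [y]))"
  have C_eq: "?C = {a, d} \<union> set xs \<union> set ys" by (auto simp: x y)
  have verts: "a \<in> pverts G" "d \<in> pverts G" using D adj_verts by (auto simp: touches_def)
  have cyc: "induced_cycle G ?C"
  proof (rule induced_cycle_close[OF path])
    show "set (x # (xs' @ d # ys') @ [y]) \<subseteq> pverts G" "a \<notin> set (x # (xs' @ d # ys') @ [y])"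
      using xs ys D E ad verts by (auto simp: x y)
    show "\<not> adj a z" if "z \<in> set (xs' @ d # ys')" for z
      using that start_a(2) end_a adj_sym[of a z] by auto
  qed (use verts start_a end_a adj_sym[of a y] in auto)
  have CD: "?C \<inter> D = set xs" and CE: "?C \<inter> E = set ys" using C_eq xs ys DE ad by auto
  show thesis
  proof (rule that[OF cyc])
    show "a \<in> ?C" "d \<in> ?C" by auto
    show "?C \<subseteq> {a, d} \<union> D \<union> E" unfolding C_eq using xs(2) ys(2) by blast
    show "conn (?C \<inter> D)" "conn (?C \<inter> E)" unfolding CD CE
      using ind_path_conn[OF ind_path_butlast[OF p1 xs(1)]] ind_path_conn[OF ind_path_tl[OF p2 ys(1)]]
      by auto
    show "touches {a} (?C \<inter> D)" "touches {a} (?C \<inter> E)" unfolding CD CE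
      using start_a end_a adj_sym[of a y] by (auto simp: touches_def x y)
    show "touches {d} (?C \<inter> E)" unfolding CE
      using ys(1,3) by (cases ys) (auto simp: touches_def)
    have eq: "(a # butlast xs) @ [last xs, d] = a # xs @ [d]"
      using append_butlast_last_id[OF xs(1)] by (metis append.assoc append_Cons append_Nil)
    have "ind_path ((a # butlast xs) @ [last xs, d])" unfolding eq by (rule xs(3))
    then have "adj (last xs) d" using ind_path_last by blast
    then show "touches {d} (?C \<inter> D)" unfolding CD
      using last_in_set[OF xs(1)] adj_sym[of d "last xs"] by (auto simp: touches_def)
  qed
qed

section \<open>Pairs of non-adjacent vertices that span a common induced cycle\<close>

definition nonadj :: "'a \<Rightarrow> 'a \<Rightarrow> bool" where
  "nonadj u v \<longleftrightarrow> u \<noteq> v \<and> \<not> adj u v"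

text \<open>
  Ordered pairs stand for two-element sets; \<open>(a, d)\<close> and \<open>(d, a)\<close> are related as soon as the
  non-adjacent vertices \<open>a\<close> and \<open>d\<close> lie on an induced cycle.
\<close>

definition cocyclic :: "(('a \<times> 'a) \<times> ('a \<times> 'a)) set" where
  "cocyclic = {((a, d), (a', d')) | a d a' d'. nonadj a d \<and> nonadj a' d' \<and>
     (\<exists>C. induced_cycle G C \<and> {a, d, a', d'} \<subseteq> C)}"

abbreviation pair_equiv :: "'a \<times> 'a \<Rightarrow> 'a \<times> 'a \<Rightarrow> bool" (infix \<open>\<approx>\<close> 50) where
  "p \<approx> q \<equiv> (p, q) \<in> cocyclic\<^sup>*"

lemma nonadj_sym: "nonadj u v \<longleftrightarrow> nonadj v u"
  unfolding nonadj_def using adj_sym[of u v] by auto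

lemma cocyclicI:
  "induced_cycle G C \<Longrightarrow> {a, d, a', d'} \<subseteq> C \<Longrightarrow> nonadj a d \<Longrightarrow> nonadj a' d' \<Longrightarrow>
     ((a, d), (a', d')) \<in> cocyclic"
  unfolding cocyclic_def by blast

lemma pair_equivI:
  "induced_cycle G C \<Longrightarrow> {a, d, a', d'} \<subseteq> C \<Longrightarrow> nonadj a d \<Longrightarrow> nonadj a' d' \<Longrightarrow> (a, d) \<approx> (a', d')"
  by (rule r_into_rtrancl) (rule cocyclicI)

lemma pair_equiv_sym: "p \<approx> q \<Longrightarrow> q \<approx> p"
proof -
  have "sym cocyclic" unfolding sym_def cocyclic_def by (auto simp: insert_commute)
  then show "p \<approx> q \<Longrightarrow> q \<approx> p" by (metis sym_rtrancl symD)
qed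

lemma pair_equiv_trans: "p \<approx> q \<Longrightarrow> q \<approx> s \<Longrightarrow> p \<approx> s"
  by (rule rtrancl_trans)

lemma pair_equiv_join: "p \<approx> q \<Longrightarrow> s \<approx> q \<Longrightarrow> p \<approx> s"
  by (rule pair_equiv_trans[OF _ pair_equiv_sym])

text \<open>The vertices at distance at least two from \<open>b\<close>, and the components that they induce.\<close>

definition far :: "'a \<Rightarrow> 'a set" where
  "far b = {v \<in> pverts G. nonadj b v}"

definition comp :: "'a \<Rightarrow> 'a set \<Rightarrow> bool" where
  "comp b D \<longleftrightarrow> conn D \<and> D \<subseteq> far b \<and> (\<forall>u\<in>D. \<forall>v\<in>far b. adj u v \<longrightarrow> v \<in> D)"

lemma comp_superset:
  assumes "conn E" "E \<subseteq> far b"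
  shows "\<exists>D. comp b D \<and> E \<subseteq> D"
proof -
  let ?P = "\<lambda>D. conn D \<and> E \<subseteq> D \<and> D \<subseteq> far b"
  have fin: "finite (far b)" using pair_finite_verts by (simp add: far_def)
  then have bound: "\<forall>D. ?P D \<longrightarrow> card D < Suc (card (far b))"
    using card_mono less_Suc_eq_le by blast
  have "?P E" using assms by simp
  then obtain D where D: "?P D" and max: "\<And>D'. ?P D' \<Longrightarrow> card D' \<le> card D"
    using ex_has_greatest_nat[of ?P E card, OF \<open>?P E\<close> bound] by auto
  have "v \<in> D" if uv: "u \<in> D" "v \<in> far b" "adj u v" for u v
  proof (rule ccontr)
    assume v: "v \<notin> D"
    have "touches {v} D" using uv adj_sym[of u v] by (auto simp: touches_def)
    then have "?P (insert v D)" using D uv conn_insert by blast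
    then have "card (insert v D) \<le> card D" by (rule max)
    moreover have "finite D" using D fin finite_subset by blast
    ultimately show False using v by simp
  qed
  then show ?thesis using D by (auto simp: comp_def)
qed

lemma comp_disjoint:
  assumes D: "comp b D" and D': "comp b D'" and ne: "D \<noteq> D'"
  shows "D \<inter> D' = {}" "\<not> touches D D'"
proof -
  have sub: "A \<subseteq> B" if A: "comp b A" and B: "comp b B" and AB: "A \<inter> B \<noteq> {}" for A B
  proof (rule ccontr)
    assume "\<not> A \<subseteq> B"
    then obtain u v where "u \<in> A \<inter> B" "v \<in> A - A \<inter> B" "adj u v"
      using conn_cut[of A "A \<inter> B"] A AB by (auto simp: comp_def)
    then show False using A B by (auto simp: comp_def)
  qed
  show disj: "D \<inter> D' = {}" using sub[OF D D'] sub[OF D' D] ne by blast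
  show "\<not> touches D D'"
  proof
    assume "touches D D'"
    then obtain u v where uv: "u \<in> D" "v \<in> D'" "adj u v" by (auto simp: touches_def)
    then have "v \<in> D" using D D' by (auto simp: comp_def)
    then show False using disj uv by blast
  qed
qed

text \<open>
  The spokes at \<open>b\<close> into \<open>D\<close> are the candidates for the two neighbours of \<open>b\<close> on an induced
  cycle through \<open>b\<close> whose other vertices lie in \<open>D\<close>.
\<close>

definition attached :: "'a \<Rightarrow> 'a set \<Rightarrow> 'a set" where
  "attached b D = {a. adj b a \<and> touches {a} D}"

definition spokes :: "'a \<Rightarrow> 'a set \<Rightarrow> ('a \<times> 'a) set" where
  "spokes b D = {(a, d). a \<in> attached b D \<and> d \<in> attached b D \<and> a \<noteq> d}"

lemma comp_neighbour:
  assumes "comp b D" "u \<in> D" "v \<in> pverts G" "adj u v" "v \<notin> D" "v \<noteq> b"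
  shows "v \<in> attached b D"
proof -
  have "v \<notin> far b" using assms by (auto simp: comp_def)
  then have "adj b v" using assms by (auto simp: far_def nonadj_def)
  moreover have "touches {v} D" using assms adj_sym[of u v] by (auto simp: touches_def)
  ultimately show ?thesis by (simp add: attached_def)
qed

end

section \<open>Unpinched triangle-free graphs\<close>

locale unpinched_triangle_free_graph = pair_graph G for G :: "'a pair_pre_digraph" +
  assumes triangle_free: "triangle_free G" and unpinched: "unpinched G"
begin

lemma neighbours_nonadj: "adj b a \<Longrightarrow> adj b d \<Longrightarrow> a \<noteq> d \<Longrightarrow> nonadj a d"
  using triangle_free adj_sym unfolding triangle_free_def nonadj_def by blast

lemma neighbour_of_neighbour_far: "adj b a \<Longrightarrow> adj a x \<Longrightarrow> x \<noteq> b \<Longrightarrow> x \<in> far b"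
  using neighbours_nonadj[of a b x] adj_sym adj_verts by (auto simp: far_def)

text \<open>
  Within a set without outgoing edges every walk that starts there stays there, which translates
  connectedness by walks into the absence of an empty cut.
\<close>

lemma conn_minus_clique:
  assumes "clique G C"
  shows "conn (pverts G - C)"
proof -
  let ?H = "with_proj G \<restriction> (pverts G - C)"
  have con: "connected ?H"
    using unpinched assms unfolding unpinched_def separated_by_clique_def by blast
  then have ne: "pverts G - C \<noteq> {}"
    by (auto simp: connected_def strongly_connected_def)
  have "touches U (pverts G - C - U)" if U: "U \<noteq> {}" "U \<subset> pverts G - C" for U
  proof (rule ccontr)
    assume cut: "\<not> ?thesis"
    obtain u v where uv: "u \<in> U" "v \<in> pverts G - C - U" using U by blast
    interpret S: pair_wf_digraph "mk_symmetric ?H"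
      using wf_digraph.wellformed_mk_symmetric[OF wellformed_induce_subgraph] .
    have "u \<rightarrow>\<^sup>*\<^bsub>with_proj (mk_symmetric ?H)\<^esub> v"
      using con uv U by (auto simp: connected_def strongly_connected_def)
    then have "v \<in> U"
    proof (induction rule: S.reachable_induct)
      case base
      show ?case by (rule uv(1))
    next
      case (step x y)
      then have "(x, y) \<in> parcs (mk_symmetric ?H)" by simp
      then have "adj x y" "y \<in> pverts G - C"
        using adj_sym by (auto simp: mk_symmetric_def arcs_ends_conv)
      then show ?case using cut step by (auto simp: touches_def)
    qed
    then show False using uv by blast
  qed
  then show ?thesis using ne by (simp add: conn_def)
qed

lemma conn_verts: "conn (pverts G)"
  and conn_minus_vertex: "b \<in> pverts G \<Longrightarrow> conn (pverts G - {b})"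
  and conn_minus_edge: "adj a b \<Longrightarrow> conn (pverts G - {a, b})"
proof -
  have cl: "clique G C"
    if C: "C \<subseteq> pverts G" "\<And>u v. u \<in> C \<Longrightarrow> v \<in> C \<Longrightarrow> u \<noteq> v \<Longrightarrow> adj u v" for C
  proof -
    have eq: "with_proj G \<restriction> C = with_proj \<lparr>pverts = C, parcs = {e \<in> parcs G. fst e \<in> C \<and> snd e \<in> C}\<rparr>"
      by (simp add: induce_subgraph_def with_proj_def)
    have "finite C" using C pair_finite_verts finite_subset by blast
    then show ?thesis
      using C unfolding clique_def complete_graph_def eq complete_digraph_pair_def by auto
  qed
  show "conn (pverts G)" using conn_minus_clique[OF cl[of "{}"]] by simp
  show "b \<in> pverts G \<Longrightarrow> conn (pverts G - {b})" using conn_minus_clique[OF cl[of "{b}"]] by simp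
  show "adj a b \<Longrightarrow> conn (pverts G - {a, b})"
    using conn_minus_clique[OF cl[of "{a, b}"]] adj_verts[of a b] adj_sym[of a b] by auto
qed

text \<open>If \<open>a\<close> were the only neighbour of \<open>b\<close> that touches \<open>D\<close>, then the edge between \<open>a\<close> and \<open>b\<close>
  would separate \<open>D\<close> from the other vertices, or \<open>a\<close> alone would separate \<open>b\<close> from \<open>D\<close>.\<close>

lemma other_attached:
  assumes D: "comp b D" and a: "adj b a"
  shows "\<exists>e \<in> attached b D. e \<noteq> a"
proof -
  have DV: "D \<subseteq> pverts G - {a, b}" and Dne: "D \<noteq> {}"
    using D a by (auto simp: comp_def far_def nonadj_def conn_def)
  show ?thesis
  proof (cases "D = pverts G - {a, b}")
    case False
    have "adj a b" using a adj_sym by blast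
    then obtain u v where "u \<in> D" "v \<in> pverts G - {a, b} - D" "adj u v"
      using conn_cut[OF conn_minus_edge DV Dne False] by blast
    then show ?thesis using comp_neighbour[OF D, of u v] by blast
  next
    case True
    have ne: "{b} \<noteq> pverts G - {a}" using DV Dne by blast
    have sub: "{b} \<subseteq> pverts G - {a}" and aV: "a \<in> pverts G" using adj_verts[OF a] a by auto
    obtain v where "v \<in> pverts G - {a} - {b}" "adj b v"
      using conn_cut[OF conn_minus_vertex[OF aV] sub _ ne] by auto
    then have "v \<in> D" "adj b v" using True by auto
    then show ?thesis using D by (auto simp: comp_def far_def nonadj_def)
  qed
qed

lemma comp_at_neighbour:
  assumes "adj b a"
  obtains D where "comp b D" "a \<in> attached b D"
proof -
  have V: "a \<in> pverts G" "b \<in> pverts G" "a \<noteq> b" using assms adj_verts by auto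
  have "pverts G - {b} \<noteq> {a}" using conn_nonempty[OF conn_minus_edge[OF assms]] by blast
  then obtain x where x: "x \<in> pverts G - {b} - {a}" "adj a x"
    using conn_cut[OF conn_minus_vertex[OF V(2)], of "{a}"] V by auto
  then have "{x} \<subseteq> far b" using neighbour_of_neighbour_far[OF assms] by auto
  then obtain D where "comp b D" "x \<in> D" using comp_superset[of "{x}" b] by auto
  then show thesis using that[of D] x assms by (auto simp: attached_def touches_def)
qed

lemma has_neighbour:
  assumes "b \<in> pverts G"
  shows "\<exists>a. adj b a"
  using conn_cut[OF conn_verts, of "{b}"] conn_nonempty[OF conn_minus_vertex[OF assms]] assms
  by auto

lemma spokes_nonempty:
  assumes b: "b \<in> pverts G"
  obtains D p where "comp b D" "p \<in> spokes b D"
proof -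
  obtain a where a: "adj b a" using has_neighbour[OF b] by blast
  then obtain D where D: "comp b D" "a \<in> attached b D" by (rule comp_at_neighbour)
  then obtain e where "e \<in> attached b D" "e \<noteq> a" using other_attached a by blast
  then show thesis using that[of D "(a, e)"] D by (auto simp: spokes_def)
qed

section \<open>Cycles through a vertex and one component of its complement\<close>

lemma cycle_through_vertex:
  assumes ad: "a \<in> attached b T" "d \<in> attached b T" "a \<noteq> d" and T: "conn T" "T \<subseteq> far b"
  obtains C where "induced_cycle G C" "{a, b, d} \<subseteq> C" "touches {a} (C \<inter> T)"
proof (rule induced_cycle_theta[of T a d "{b}"])
  have adj: "adj b a" "adj b d" using ad by (auto simp: attached_def)
  show "T \<subseteq> pverts G" "T \<inter> {b} = {}" "\<not> touches T {b}" "a \<notin> T \<union> {b}" "d \<notin> T \<union> {b}"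
    using T adj adj_sym[of b] by (auto simp: far_def nonadj_def touches_def)
  show "a \<noteq> d" "\<not> adj a d" using neighbours_nonadj[OF adj ad(3)] by (auto simp: nonadj_def)
  show "touches {a} {b}" "touches {d} {b}" "{b} \<subseteq> pverts G"
    using adj adj_sym[of b] adj_verts by (auto simp: touches_def)
  show "touches {a} T" "touches {d} T" using ad by (auto simp: attached_def)
  show "conn T" "conn {b}" using T by auto
next
  fix C assume "induced_cycle G C" "a \<in> C" "d \<in> C" "touches {a} (C \<inter> T)" "conn (C \<inter> {b})"
  then show thesis using that[of C] conn_nonempty by blast
qed

text \<open>If \<open>x\<close> is the only contact of \<open>p\<close> with \<open>T\<close>, every cycle that enters \<open>T\<close> from \<open>p\<close>
  contains the non-adjacent pair \<open>b, x\<close>, whatever its second spoke.\<close>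

lemma spoke_equiv_sole_contact:
  assumes pq: "p \<in> attached b T" "q \<in> attached b T" "p \<noteq> q" and T: "conn T" "T \<subseteq> far b"
    and sole: "\<not> touches {p} (T - {x})"
  shows "(p, q) \<approx> (b, x)" "(q, p) \<approx> (b, x)"
proof -
  obtain C where C: "induced_cycle G C" "{p, b, q} \<subseteq> C" "touches {p} (C \<inter> T)"
    using cycle_through_vertex[OF pq T] .
  have x: "x \<in> C" "x \<in> T" using C(3) sole by (auto simp: touches_def)
  have "nonadj p q" "nonadj b x"
    using neighbours_nonadj pq x T by (auto simp: attached_def far_def)
  then show "(p, q) \<approx> (b, x)" "(q, p) \<approx> (b, x)"
    using pair_equivI[OF C(1)] C(2) x nonadj_sym by simp_all
qed

text \<open>
  In a minimal connected set that touches all three neighbours, two of them have a unique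
  contact (or there is just one vertex, which serves all three). The unique contact \<open>x\<close> of a
  neighbour makes the two pairs containing this neighbour equivalent, both being equivalent to
  \<open>b, x\<close>; two such steps relate all three pairs.
\<close>

lemma spokes_equiv_three:
  assumes ade: "a \<in> attached b D" "d \<in> attached b D" "e \<in> attached b D" "a \<noteq> d" "a \<noteq> e" "d \<noteq> e"
    and D: "conn D" "D \<subseteq> far b"
  shows "(a, d) \<approx> (a, e)"
proof -
  have fin: "finite D"
    using D pair_finite_verts finite_subset[of D "pverts G"] by (auto simp: far_def)
  have adj: "adj b a" "adj b d" "adj b e" using ade by (auto simp: attached_def)
  let ?F = "{{a}, {d}, {e}}"
  have pivot: "(p, q) \<approx> (b, x)" "(q, p) \<approx> (b, x)"
    if "T \<subseteq> D" "conn T" "\<And>X. X \<in> ?F \<Longrightarrow> touches X T" "p \<in> {a, d, e}" "q \<in> {a, d, e}" "p \<noteq> q"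
      "\<not> touches {p} (T - {x})" for T p q x
    using spoke_equiv_sole_contact[of p b T q x] that adj D by (auto simp: attached_def)
  show ?thesis
  proof (rule minimal_touching[OF fin D(1), of ?F])
    show "touches X D" if "X \<in> ?F" for X using that ade by (auto simp: attached_def)
  next
    fix T x
    assume T: "T \<subseteq> D" "T = {x}" "\<And>X. X \<in> ?F \<Longrightarrow> touches X T"
    have "conn T" "\<not> touches {a} (T - {x})" using T(2) by (auto simp: touches_def)
    note piv = pivot(1)[OF T(1) this(1) T(3) _ _ _ this(2)]
    have "(a, d) \<approx> (b, x)" "(a, e) \<approx> (b, x)" using piv ade by simp_all
    then show ?thesis by (rule pair_equiv_join)
  next
    fix T X Y x y
    assume T: "T \<subseteq> D" "conn T" "\<And>X. X \<in> ?F \<Longrightarrow> touches X T"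
      and XY: "X \<in> ?F" "Y \<in> ?F" "X \<noteq> Y" "\<not> touches X (T - {x})" "\<not> touches Y (T - {y})"
    note piv = pivot[OF T]
    have via_a: "(a, d) \<approx> (a, e)" if "\<not> touches {a} (T - {z})" for z
      by (rule pair_equiv_join[of _ "(b, z)"]; rule piv(1)) (use that ade in auto)
    have via_de: "(a, d) \<approx> (a, e)"
      if "\<not> touches {d} (T - {z})" "\<not> touches {e} (T - {w})" for z w
    proof -
      have "(a, d) \<approx> (b, z)" "(d, e) \<approx> (b, z)" "(d, e) \<approx> (b, w)" "(a, e) \<approx> (b, w)"
        using piv(2)[of d a z] piv(1)[of d e z] piv(2)[of e d w] piv(2)[of e a w] that ade by auto
      then show ?thesis by (meson pair_equiv_join pair_equiv_sym)
    qed
    consider "X = {a}" | "Y = {a}" | "X = {d}" "Y = {e}" | "X = {e}" "Y = {d}"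
      using XY(1-3) by blast
    then show ?thesis using via_a via_de XY(4,5) by cases auto
  qed
qed

lemma spokes_swap_equiv:
  assumes "(a, d) \<in> spokes b D" "conn D" "D \<subseteq> far b"
  shows "(a, d) \<approx> (d, a)"
proof -
  have ad: "a \<in> attached b D" "d \<in> attached b D" "a \<noteq> d" using assms by (auto simp: spokes_def)
  obtain C where "induced_cycle G C" "{a, b, d} \<subseteq> C"
    using cycle_through_vertex[OF ad assms(2,3)] by blast
  moreover have "nonadj a d" using neighbours_nonadj ad by (auto simp: attached_def)
  ultimately show ?thesis using pair_equivI[of C a d d a] nonadj_sym by simp
qed

lemma spokes_equiv:
  assumes p: "p \<in> spokes b D" and q: "q \<in> spokes b D" and D: "conn D" "D \<subseteq> far b"
  shows "p \<approx> q"
proof -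
  have three: "(a, d) \<approx> (a, e)" if "(a, d) \<in> spokes b D" "(a, e) \<in> spokes b D" for a d e
    using that spokes_equiv_three[of a b D d e] D by (cases "d = e") (auto simp: spokes_def)
  obtain a d a' d' where pq: "p = (a, d)" "q = (a', d')" by (metis surj_pair)
  show ?thesis
  proof (cases "a = a'")
    case True
    then show ?thesis using three p q pq by blast
  next
    case False
    then have m: "(a, a') \<in> spokes b D" "(a', a) \<in> spokes b D"
      using p q pq by (auto simp: spokes_def)
    have "(a, d) \<approx> (a, a')" "(a, a') \<approx> (a', a)" "(a', a) \<approx> (a', d')"
      using three[of a d a'] spokes_swap_equiv[OF m(1) D] three[of a' a d'] m p q pq by auto
    then show ?thesis unfolding pq by (meson pair_equiv_trans)
  qed
qed

section \<open>Passing between components and between vertices\<close>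

text \<open>
  The two components are joined by a connected set \<open>W\<close> that avoids \<open>a\<close> and \<open>b\<close>. If \<open>a\<close> has a
  neighbour in \<open>W\<close>, the component of that neighbour is an intermediate station, and the
  parts of \<open>W\<close> leading to it are smaller. Otherwise pass to a minimal connected subset of \<open>W\<close>
  that touches both components. If it is a single vertex, that vertex is a second common spoke.
  If not, it touches the first component only at a vertex \<open>x\<close> and the second one only at a
  vertex \<open>y\<close>, and both are neighbours of \<open>b\<close>. The induced cycle that runs from \<open>a\<close> through the
  first component to \<open>x\<close> and returns through the subset and the second component contains \<open>a\<close>,
  \<open>x\<close> and \<open>y\<close>, hence a pair of spokes of each component.
\<close>

lemma spokes_equiv_linked:
  assumes D: "comp b D" "comp b D'" "D \<noteq> D'" and ad: "(a, d) \<in> spokes b D" "(a, d') \<in> spokes b D'"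
    and W: "conn W" "W \<subseteq> pverts G - {a, b} - D - D'" "touches D W" "touches D' W"
  shows "(a, d) \<approx> (a, d')"
  using assms
proof (induction "card W" arbitrary: W D D' d d' rule: less_induct)
  case less
  note D = less.prems(1-3) and ad = less.prems(4,5) and W = less.prems(6-)
  have finW: "finite W" using W(2) pair_finite_verts by (meson Diff_subset finite_subset order_trans)
  have Dc: "conn D" "D \<subseteq> far b" "conn D'" "D' \<subseteq> far b" using D by (auto simp: comp_def)
  have farb: "far b \<subseteq> pverts G" "b \<notin> far b" by (auto simp: far_def nonadj_def)
  have ab: "adj b a" using ad by (auto simp: spokes_def attached_def)
  have a_far: "a \<notin> far b" using ab by (auto simp: far_def nonadj_def)
  have aD: "touches {a} D" "touches {a} D'" using ad by (auto simp: spokes_def attached_def)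
  show ?case
  proof (cases "touches {a} W")
    case True
    then obtain w where w: "w \<in> W" "adj a w" by (auto simp: touches_def)
    then have "w \<in> far b" using neighbour_of_neighbour_far[OF ab] W(2) by blast
    then obtain B where B: "comp b B" "w \<in> B" using comp_superset[of "{w}" b] by auto
    have aB: "a \<in> attached b B" using ab w B by (auto simp: attached_def touches_def)
    obtain e where "e \<in> attached b B" "e \<noteq> a" using other_attached[OF B(1) ab] by blast
    then have ae: "(a, e) \<in> spokes b B" using aB by (auto simp: spokes_def)
    have shorter: "\<exists>W'. W' \<subseteq> W - B \<and> conn W' \<and> touches K W' \<and> touches B W' \<and> card W' < card W"
      if K: "comp b K" "K \<noteq> B" "touches K W" "W \<inter> K = {}" for K
    proof -
      have disj: "K \<inter> B = {}" "\<not> touches K B" using comp_disjoint[OF K(1) B(1) K(2)] .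
      have Kc: "conn K" using K(1) by (simp add: comp_def)
      have "\<not> touches K (B \<inter> W)" using disj(2) touches_mono by blast
      then have "\<exists>W' \<subseteq> K \<union> W - K - B \<inter> W. conn W' \<and> touches K W' \<and> touches (B \<inter> W) W'"
        using conn_set_between[of "K \<union> W" K "B \<inter> W"] conn_Un[OF Kc W(1) K(3)] conn_nonempty[OF Kc]
          disj B(2) w(1) by blast
      then obtain W' where W': "W' \<subseteq> K \<union> W - K - B \<inter> W" "conn W'" "touches K W'"
          "touches (B \<inter> W) W'" by blast
      have "W' \<subset> W" using W'(1) B(2) w(1) by blast
      then have "card W' < card W" by (rule psubset_card_mono[OF finW])
      moreover have "touches B W'" using W'(4) touches_mono[of "B \<inter> W" W' B W'] by blast
      moreover have "W' \<subseteq> W - B" using W'(1) by blast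
      ultimately show ?thesis using W' by blast
    qed
    have ne: "D \<noteq> B" "D' \<noteq> B" using B(2) w(1) W(2) by blast+
    obtain W1 where W1: "W1 \<subseteq> W - B" "conn W1" "touches D W1" "touches B W1" "card W1 < card W"
      using shorter[of D] D ne W(2,3) by blast
    obtain W2 where W2: "W2 \<subseteq> W - B" "conn W2" "touches D' W2" "touches B W2" "card W2 < card W"
      using shorter[of D'] D ne W(2,4) by blast
    have "W1 \<subseteq> pverts G - {a, b} - D - B" "W2 \<subseteq> pverts G - {a, b} - B - D'"
      using W1(1) W2(1) W(2) by blast+
    then have "(a, d) \<approx> (a, e)" "(a, e) \<approx> (a, d')"
      using less.hyps[OF W1(5) D(1) B(1) ne(1) ad(1) ae W1(2)]
        less.hyps[OF W2(5) B(1) D(2) _ ae ad(2) W2(2)] ne(2) W1 W2 by auto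
    then show ?thesis by (rule pair_equiv_trans)
  next
    case False
    have contact: "x \<in> attached b K \<and> (a, x) \<in> spokes b K"
      if "comp b K" "touches {a} K" "u \<in> K" "adj u x" "x \<in> W" "W \<inter> K = {}" for x u K
    proof -
      have "x \<in> attached b K" using comp_neighbour[of b K u x] that W(2) by blast
      moreover have "a \<noteq> x" using that W(2) by blast
      ultimately show ?thesis using that ab by (auto simp: spokes_def attached_def)
    qed
    have WD: "W \<inter> D = {}" "W \<inter> D' = {}" using W(2) by blast+
    show ?thesis
    proof (rule minimal_touching[OF finW W(1), of "{D, D'}"])
      show "touches X W" if "X \<in> {D, D'}" for X using that W by blast
    next
      fix T x
      assume T: "T \<subseteq> W" "T = {x}" "\<And>X. X \<in> {D, D'} \<Longrightarrow> touches X T"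
      obtain u where u: "u \<in> D" "adj u x" using T(3)[of D] T(2) by (auto simp: touches_def)
      obtain u' where u': "u' \<in> D'" "adj u' x" using T(3)[of D'] T(2) by (auto simp: touches_def)
      have "(a, x) \<in> spokes b D" "(a, x) \<in> spokes b D'"
        using contact[OF D(1) aD(1) u] contact[OF D(2) aD(2) u'] T WD by auto
      then have "(a, d) \<approx> (a, x)" "(a, x) \<approx> (a, d')"
        using spokes_equiv[OF ad(1)] spokes_equiv[OF _ ad(2)] Dc by auto
      then show ?thesis by (rule pair_equiv_trans)
    next
      fix T X Y x' y'
      assume T: "T \<subseteq> W" "conn T" "\<And>X. X \<in> {D, D'} \<Longrightarrow> touches X T"
        and XY: "X \<in> {D, D'}" "Y \<in> {D, D'}" "X \<noteq> Y" "x' \<in> T" "y' \<in> T" "x' \<noteq> y'"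
          "conn (T - {x'})" "conn (T - {y'})" "\<not> touches X (T - {x'})" "\<not> touches Y (T - {y'})"
      obtain x y where xy: "x \<in> T" "y \<in> T" "x \<noteq> y" "conn (T - {x})"
        "\<not> touches D (T - {x})" "\<not> touches D' (T - {y})"
      proof (cases "X = D")
        case True
        then have "Y = D'" using XY by blast
        then show thesis using that[of x' y'] True XY by blast
      next
        case False
        then have "X = D'" "Y = D" using XY by blast+
        then show thesis using that[of y' x'] XY by blast
      qed
      obtain u where u: "u \<in> D" "adj u x" using T(3)[of D] xy(5) by (auto simp: touches_def)
      obtain u' where u': "u' \<in> D'" "adj u' y" using T(3)[of D'] xy(6) by (auto simp: touches_def)
      have ax: "(a, x) \<in> spokes b D" and ay: "(a, y) \<in> spokes b D'"
        using contact[OF D(1) aD(1) u] contact[OF D(2) aD(2) u'] T(1) xy(1,2) WD by auto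
      have nonadj: "nonadj a x" "nonadj a y"
        using neighbours_nonadj ax ay by (auto simp: spokes_def attached_def)
      let ?E = "(T - {x}) \<union> D'"
      have "(a, x) \<approx> (a, y)"
      proof (rule induced_cycle_theta[of D a x ?E])
        show "D \<subseteq> pverts G" "?E \<subseteq> pverts G" "conn D" using Dc farb T(1) W(2) by blast+
        show "touches {a} D" "touches {x} D" using ax by (auto simp: spokes_def attached_def)
        show "conn ?E"
          using conn_Un[OF xy(4) Dc(3)] u' xy(2,3) touches_sym[of D' "T - {x}"]
          by (auto simp: touches_def)
        show "touches {a} ?E" by (rule touches_mono[OF aD(2)]) auto
        show "touches {x} ?E"
          using conn_touches_rest[OF T(2) xy(1)] xy(2,3) touches_mono[of "{x}" "T - {x}" "{x}" ?E]
          by blast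
        show "D \<inter> ?E = {}" using comp_disjoint(1)[OF D] WD T(1) by blast
        show "\<not> touches D ?E" using comp_disjoint(2)[OF D] xy(5) by (auto simp: touches_def)
        show "a \<noteq> x" "\<not> adj a x" using nonadj by (auto simp: nonadj_def)
        show "a \<notin> D \<union> ?E" using a_far Dc T(1) W(2) by blast
        show "x \<notin> D \<union> ?E" using xy(1) T(1) WD by blast
      next
        fix C
        assume C: "induced_cycle G C" "a \<in> C" "x \<in> C" and CE: "conn (C \<inter> ?E)"
          "touches {a} (C \<inter> ?E)" "touches {x} (C \<inter> ?E)"
        \<comment> \<open>The return arc starts in \<open>D'\<close>, ends in \<open>T\<close>, and can only cross between them at \<open>y\<close>.\<close>
        have "C \<inter> D' \<noteq> {}"
          using CE(2) False T(1) by (auto simp: touches_def)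
        moreover have "\<not> touches {x} D'"
          using xy(1,3,6) touches_sym[of "{x}" D'] by (auto simp: touches_def)
        then have "C \<inter> D' \<noteq> C \<inter> ?E" using CE(3) by (auto simp: touches_def)
        ultimately obtain s t where st: "s \<in> C \<inter> D'" "t \<in> C \<inter> ?E - C \<inter> D'" "adj s t"
          using conn_cut[OF CE(1), of "C \<inter> D'"] by blast
        then have "t = y" using xy(6) by (auto simp: touches_def)
        then have "y \<in> C" using st by blast
        then show "(a, x) \<approx> (a, y)" using pair_equivI[OF C(1)] C(2,3) nonadj by simp
      qed
      moreover have "(a, d) \<approx> (a, x)" "(a, y) \<approx> (a, d')"
        using spokes_equiv[OF ad(1) ax] spokes_equiv[OF ay ad(2)] Dc by auto
      ultimately show ?thesis by (meson pair_equiv_trans)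
    qed
  qed
qed

text \<open>Deleting the edge between \<open>a\<close> and \<open>b\<close> with its end points leaves a connected graph, which
  provides the connecting set \<open>W\<close>.\<close>

lemma spokes_equiv_common_attachment:
  assumes D: "comp b D" "comp b D'" and a: "a \<in> attached b D" "a \<in> attached b D'"
    and p: "p \<in> spokes b D" "q \<in> spokes b D'"
  shows "p \<approx> q"
proof (cases "D = D'")
  case True
  then show ?thesis using spokes_equiv p D by (auto simp: comp_def)
next
  case False
  have ab: "adj b a" using a by (simp add: attached_def)
  obtain d where "d \<in> attached b D" "d \<noteq> a" using other_attached[OF D(1) ab] by blast
  then have d: "(a, d) \<in> spokes b D" using a by (auto simp: spokes_def)
  obtain d' where "d' \<in> attached b D'" "d' \<noteq> a" using other_attached[OF D(2) ab] by blast
  then have d': "(a, d') \<in> spokes b D'" using a by (auto simp: spokes_def)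
  have "adj a b" using ab adj_sym by blast
  then have K: "conn (pverts G - {a, b})" by (rule conn_minus_edge)
  have sub: "D \<subseteq> pverts G - {a, b}" "D' \<subseteq> pverts G - {a, b}"
    using D ab by (auto simp: comp_def far_def nonadj_def)
  have ne: "D \<noteq> {}" "D' \<noteq> {}" using D conn_nonempty by (auto simp: comp_def)
  obtain W where W: "W \<subseteq> pverts G - {a, b} - D - D'" "conn W" "touches D W" "touches D' W"
    using conn_set_between[OF K sub ne comp_disjoint[OF D False]] by blast
  have "(a, d) \<approx> (a, d')" by (rule spokes_equiv_linked[OF D False d d' W(2,1,3,4)])
  moreover have "p \<approx> (a, d)" "(a, d') \<approx> q"
    using spokes_equiv[OF p(1) d] spokes_equiv[OF d' p(2)] D by (auto simp: comp_def)
  ultimately show ?thesis by (meson pair_equiv_trans)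
qed

text \<open>
  Take the components whose spokes are equivalent to \<open>p\<close>, together with the neighbours of \<open>b\<close>
  attached to them. No edge leaves this set in the graph without \<open>b\<close>: an attached neighbour is
  adjacent only to \<open>b\<close> and to vertices of components to which it is attached as well, and these
  are equivalent by the previous lemma. As \<open>b\<close> does not separate the graph, the set is everything.
\<close>

lemma spokes_equiv_vertex:
  assumes b: "b \<in> pverts G" and D: "comp b D" "comp b D'" and p: "p \<in> spokes b D" "q \<in> spokes b D'"
  shows "p \<approx> q"
proof -
  define S where "S = {B. comp b B \<and> (\<forall>s\<in>spokes b B. p \<approx> s)}"
  define U where "U = \<Union> S \<union> (\<Union>B\<in>S. attached b B)"
  have DS: "D \<in> S" using D(1) p(1) spokes_equiv by (auto simp: S_def comp_def)
  have step: "B' \<in> S" if B: "B \<in> S" "comp b B'" "a \<in> attached b B" "a \<in> attached b B'" for B B' a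
  proof -
    have cB: "comp b B" and pB: "\<And>s. s \<in> spokes b B \<Longrightarrow> p \<approx> s" using B(1) by (auto simp: S_def)
    have "adj b a" using B(3) by (simp add: attached_def)
    then obtain e where "e \<in> attached b B" "e \<noteq> a" using other_attached[OF cB] by blast
    then have e: "(a, e) \<in> spokes b B" using B(3) by (auto simp: spokes_def)
    have "p \<approx> s" if "s \<in> spokes b B'" for s
      using pB[OF e] spokes_equiv_common_attachment[OF cB B(2-4) e that] by (rule pair_equiv_trans)
    then show ?thesis using B(2) by (simp add: S_def)
  qed
  have UV: "U \<subseteq> pverts G - {b}"
    using adj_verts by (fastforce simp: U_def S_def comp_def far_def nonadj_def attached_def)
  have "U = pverts G - {b}"
  proof (rule ccontr)
    assume ne: "U \<noteq> pverts G - {b}"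
    have "D \<noteq> {}" using D conn_nonempty by (auto simp: comp_def)
    then have "U \<noteq> {}" using DS by (auto simp: U_def)
    then obtain u v where uv: "u \<in> U" "v \<in> pverts G - {b}" "v \<notin> U" "adj u v"
      using conn_cut[OF conn_minus_vertex[OF b] UV _ ne] by blast
    from uv(1) consider B where "B \<in> S" "u \<in> B" | B where "B \<in> S" "u \<in> attached b B"
      by (auto simp: U_def)
    then show False
    proof cases
      case 1
      then have "v \<notin> B" "comp b B" using uv by (auto simp: U_def S_def)
      then have "v \<in> attached b B" using comp_neighbour 1 uv by blast
      then show False using 1 uv by (auto simp: U_def)
    next
      case 2
      then have bu: "adj b u" by (simp add: attached_def)
      then have "{v} \<subseteq> far b" using neighbour_of_neighbour_far[OF bu uv(4)] uv by auto
      then obtain B' where B': "comp b B'" "v \<in> B'" using comp_superset[of "{v}" b] by auto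
      then have "u \<in> attached b B'" using bu uv by (auto simp: attached_def touches_def)
      then have "B' \<in> S" using step[OF 2(1) B'(1) 2(2)] by blast
      then show False using B' uv by (auto simp: U_def)
    qed
  qed
  then have "D' \<subseteq> U" using D(2) by (auto simp: comp_def far_def nonadj_def)
  moreover obtain x where x: "x \<in> D'" using D(2) conn_nonempty[of D'] by (auto simp: comp_def)
  moreover have "x \<notin> attached b B" for B
    using x D(2) by (auto simp: comp_def far_def nonadj_def attached_def)
  ultimately obtain B where B: "B \<in> S" "x \<in> B" by (auto simp: U_def)
  then have "B = D'" using comp_disjoint(1)[of b B D'] D(2) x by (auto simp: S_def)
  then show ?thesis using B p(2) by (auto simp: S_def)
qed

text \<open>
  A cycle with consecutive vertices \<open>d, b, b', x\<close> contains the spokes \<open>b', d\<close> of \<open>b\<close> and the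
  spokes \<open>b, x\<close> of \<open>b'\<close>.
\<close>

lemma spokes_equiv_edge:
  assumes bb': "adj b b'"
  obtains D p D' q where "comp b D" "p \<in> spokes b D" "comp b' D'" "q \<in> spokes b' D'" "p \<approx> q"
proof -
  obtain D where D: "comp b D" "b' \<in> attached b D" using bb' by (rule comp_at_neighbour)
  obtain d where d: "d \<in> attached b D" "d \<noteq> b'" using other_attached[OF D(1) bb'] by blast
  have Dc: "conn D" "D \<subseteq> far b" using D by (auto simp: comp_def)
  have finD: "finite D"
    using Dc pair_finite_verts finite_subset[of D "pverts G"] by (auto simp: far_def)
  have bd: "adj b d" using d by (simp add: attached_def)
  have "\<exists>T x. T \<subseteq> D \<and> conn T \<and> touches {b'} T \<and> touches {d} T \<and> x \<in> T \<and>
      \<not> touches {b'} (T - {x}) \<and> conn (insert d (T - {x})) \<and> touches {x} (insert d (T - {x}))"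
  proof (rule minimal_touching[OF finD Dc(1), of "{{b'}, {d}}"])
    show "touches X D" if "X \<in> {{b'}, {d}}" for X using that D d by (auto simp: attached_def)
  next
    fix T x
    assume T: "T \<subseteq> D" "T = {x}" "\<And>X. X \<in> {{b'}, {d}} \<Longrightarrow> touches X T"
    have "conn T" "touches {b'} T" "touches {d} T" "x \<in> T" "\<not> touches {b'} (T - {x})"
      using T by (auto simp: touches_def)
    moreover have "conn (insert d (T - {x}))" using T(2) by simp
    moreover have "touches {x} (insert d (T - {x}))"
      using T(2,3) adj_sym[of d x] by (auto simp: touches_def)
    ultimately show ?thesis using T(1) by blast
  next
    fix T X Y x' y'
    assume T: "T \<subseteq> D" "conn T" "\<And>X. X \<in> {{b'}, {d}} \<Longrightarrow> touches X T"
      and XY: "X \<in> {{b'}, {d}}" "Y \<in> {{b'}, {d}}" "X \<noteq> Y" "x' \<in> T" "y' \<in> T" "x' \<noteq> y'"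
        "conn (T - {x'})" "conn (T - {y'})" "\<not> touches X (T - {x'})" "\<not> touches Y (T - {y'})"
    obtain x y where xy: "x \<in> T" "y \<in> T" "x \<noteq> y" "conn (T - {x})"
      "\<not> touches {b'} (T - {x})" "\<not> touches {d} (T - {y})"
    proof (cases "X = {b'}")
      case True
      then have "Y = {d}" using XY by blast
      then show thesis using that[of x' y'] True XY by blast
    next
      case False
      then have "X = {d}" "Y = {b'}" using XY by blast+
      then show thesis using that[of y' x'] XY by blast
    qed
    have dT: "touches {d} T" using T(3) by simp
    then have "touches {d} (T - {x})" using xy(2,3,6) by (auto simp: touches_def)
    then have "conn (insert d (T - {x}))" by (rule conn_insert[OF xy(4)])
    moreover have "touches {x} (T - {x})" using conn_touches_rest[OF T(2) xy(1)] xy(2,3) by blast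
    then have "touches {x} (insert d (T - {x}))" by (rule touches_mono) auto
    ultimately show ?thesis using T(1,2) T(3)[of "{b'}"] dT xy(1,5) by blast
  qed
  then obtain T x where T: "T \<subseteq> D" "conn T" "touches {b'} T" "touches {d} T" "x \<in> T"
    "\<not> touches {b'} (T - {x})" "conn (insert d (T - {x}))" "touches {x} (insert d (T - {x}))"
    by blast
  have b'b: "adj b' b" using bb' adj_sym by blast
  have b'x: "adj b' x" using T(3,6) by (auto simp: touches_def)
  have "x \<in> far b" using T(1,5) Dc by blast
  then have "x \<noteq> b" by (auto simp: far_def nonadj_def)
  have "b' \<notin> D" using bb' Dc by (auto simp: far_def nonadj_def)
  then have "insert d (T - {x}) \<subseteq> far b'"
    using T(1,6) Dc neighbour_of_neighbour_far[OF b'b bd d(2)]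
    by (auto simp: far_def nonadj_def touches_def)
  then obtain D' where D': "comp b' D'" "insert d (T - {x}) \<subseteq> D'"
    using comp_superset[OF T(7)] by blast
  have "touches {b} (insert d (T - {x}))" using bd by (auto simp: touches_def)
  then have "b \<in> attached b' D'" "x \<in> attached b' D'"
    using b'b b'x T(8) D'(2) touches_mono[of _ _ _ D'] by (auto simp: attached_def)
  then have q: "(b, x) \<in> spokes b' D'" using \<open>x \<noteq> b\<close> by (auto simp: spokes_def)
  have "b' \<in> attached b T" "d \<in> attached b T" using bb' bd T by (auto simp: attached_def)
  then have "(b', d) \<approx> (b, x)"
    using spoke_equiv_sole_contact(1)[of b' b T d x] d(2) T Dc by auto
  moreover have "(b', d) \<in> spokes b D" using D(2) d by (auto simp: spokes_def)
  ultimately show thesis using that D(1) D'(1) q by blast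
qed

lemma spokes_equiv_all:
  assumes b: "b \<in> pverts G" "comp b D" "p \<in> spokes b D"
    and b': "b' \<in> pverts G" "comp b' D'" "q \<in> spokes b' D'"
  shows "p \<approx> q"
proof -
  define U where "U = {v \<in> pverts G. \<forall>B s. comp v B \<longrightarrow> s \<in> spokes v B \<longrightarrow> p \<approx> s}"
  have "b \<in> U" using b spokes_equiv_vertex by (auto simp: U_def)
  have "U = pverts G"
  proof (rule ccontr)
    assume "U \<noteq> pverts G"
    moreover have "U \<subseteq> pverts G" by (auto simp: U_def)
    ultimately obtain u v where uv: "u \<in> U" "v \<in> pverts G - U" "adj u v"
      using conn_cut[OF conn_verts, of U] \<open>b \<in> U\<close> by blast
    obtain B s B' s' where s: "comp u B" "s \<in> spokes u B" "comp v B'" "s' \<in> spokes v B'" "s \<approx> s'"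
      using spokes_equiv_edge[OF uv(3)] by blast
    have "p \<approx> s" using uv(1) s(1,2) unfolding U_def by blast
    then have ps': "p \<approx> s'" using s(5) by (rule pair_equiv_trans)
    have "p \<approx> t" if "comp v K" "t \<in> spokes v K" for K t
      using ps' spokes_equiv_vertex[OF _ s(3) that(1) s(4) that(2)] uv(2) pair_equiv_trans by blast
    then show False using uv(2) by (auto simp: U_def)
  qed
  then show ?thesis using b' unfolding U_def by blast
qed

definition cycle_link :: "('a set \<times> 'a set) set" where
  "cycle_link = {(C, C'). induced_cycle G C \<and> induced_cycle G C' \<and>
     (\<exists>a d. nonadj a d \<and> {a, d} \<subseteq> C \<inter> C')}"

text \<open>Each pair of a chain of equivalent pairs lies on the cycle before it and on the cycle after
  it, so these two cycles are linked.\<close>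

lemma cycle_link_of_pair_equiv:
  assumes "p \<approx> q" "nonadj (fst p) (snd p)" "induced_cycle G C" "{fst p, snd p} \<subseteq> C"
    and "induced_cycle G C'" "{fst q, snd q} \<subseteq> C'"
  shows "(C, C') \<in> cycle_link\<^sup>*"
  using assms
proof (induction arbitrary: C' rule: rtrancl_induct)
  case base
  then have "(C, C') \<in> cycle_link" unfolding cycle_link_def by auto
  then show ?case by blast
next
  case (step q s)
  obtain C1 where C1: "induced_cycle G C1" "{fst q, snd q, fst s, snd s} \<subseteq> C1" "nonadj (fst s) (snd s)"
    using step(2) by (auto simp: cocyclic_def)
  have "(C, C1) \<in> cycle_link\<^sup>*" using step C1 by auto
  moreover have "(C1, C') \<in> cycle_link" using step.prems C1 by (auto simp: cycle_link_def)
  ultimately show ?case by (rule rtrancl_into_rtrancl)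
qed

theorem linked_cycles_cover:
  obtains c where "\<And>v. v \<in> pverts G \<Longrightarrow> induced_cycle G (c v) \<and> v \<in> c v"
    and "\<And>v w. v \<in> pverts G \<Longrightarrow> w \<in> pverts G \<Longrightarrow> (c v, c w) \<in> cycle_link\<^sup>*"
proof -
  define good where "good v C \<longleftrightarrow> induced_cycle G C \<and> v \<in> C \<and>
    (\<exists>B p. comp v B \<and> p \<in> spokes v B \<and> {fst p, snd p} \<subseteq> C)" for v C
  have "\<exists>C. good v C" if v: "v \<in> pverts G" for v
  proof -
    obtain B p where B: "comp v B" "p \<in> spokes v B" using spokes_nonempty[OF v] .
    then have att: "fst p \<in> attached v B" "snd p \<in> attached v B" "fst p \<noteq> snd p"
      by (auto simp: spokes_def)
    have "conn B" "B \<subseteq> far v" using B by (auto simp: comp_def)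
    from cycle_through_vertex[OF att this] obtain C where
      "induced_cycle G C" "{fst p, v, snd p} \<subseteq> C" by blast
    then show ?thesis using B unfolding good_def by blast
  qed
  then obtain c where c: "\<And>v. v \<in> pverts G \<Longrightarrow> good v (c v)" by metis
  have "(c v, c w) \<in> cycle_link\<^sup>*" if vw: "v \<in> pverts G" "w \<in> pverts G" for v w
  proof -
    obtain B p where p: "comp v B" "p \<in> spokes v B" "{fst p, snd p} \<subseteq> c v"
      using c[OF vw(1)] unfolding good_def by blast
    obtain B' q where q: "comp w B'" "q \<in> spokes w B'" "{fst q, snd q} \<subseteq> c w"
      using c[OF vw(2)] unfolding good_def by blast
    have "nonadj (fst p) (snd p)"
      using neighbours_nonadj p(2) by (auto simp: spokes_def attached_def)
    then show ?thesis
      using cycle_link_of_pair_equiv[OF spokes_equiv_all[OF vw(1) p(1,2) vw(2) q(1,2)]]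
        c[OF vw(1)] c[OF vw(2)] p(3) q(3) unfolding good_def by blast
  qed
  then show thesis using that[of c] c unfolding good_def by blast
qed

end

section \<open>Cosets of parabolic subgroups\<close>

lemma carrier_raag:
  "carrier (raag \<Gamma>) = (\<lambda>w. word_rel (pverts \<Gamma>) (raag_relations \<Gamma>) `` {w}) ` words (pverts \<Gamma>)"
  by (auto simp: raag_def presented_group_def quotient_def)

lemma raag_gen_closed: "v \<in> pverts \<Gamma> \<Longrightarrow> raag_gen \<Gamma> v \<in> carrier (raag \<Gamma>)"
  by (simp add: carrier_raag raag_gen_def)

lemma parabolic_subgroup: "U \<subseteq> pverts \<Gamma> \<Longrightarrow> subgroup (parabolic \<Gamma> U) (raag \<Gamma>)"
  unfolding parabolic_def
  by (rule group.generate_is_subgroup[OF group_raag]) (auto intro: raag_gen_closed)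

lemma parabolic_mono: "U \<subseteq> U' \<Longrightarrow> parabolic \<Gamma> U \<subseteq> parabolic \<Gamma> U'"
  unfolding parabolic_def by (rule group.mono_generate[OF group_raag image_mono])

lemma raag_letter_in_parabolic:
  assumes v: "v \<in> pverts \<Gamma>" "v \<in> U"
  shows "word_rel (pverts \<Gamma>) (raag_relations \<Gamma>) `` {[(v, b)]} \<in> parabolic \<Gamma> U"
proof -
  interpret group "raag \<Gamma>" by (rule group_raag)
  let ?c = "\<lambda>w. word_rel (pverts \<Gamma>) (raag_relations \<Gamma>) `` {w}"
  have gen: "raag_gen \<Gamma> v \<in> raag_gen \<Gamma> ` U" using v(2) by (rule imageI)
  show ?thesis
  proof (cases b)
    case True
    then show ?thesis using generate.incl[OF gen] by (simp add: parabolic_def raag_gen_def)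
  next
    case False
    have "([(v, False), (v, True)], []) \<in> word_rel (pverts \<Gamma>) (raag_relations \<Gamma>)"
      using word_rel.cancel[of "[]" _ "[]" v False] v(1) by simp
    then have "?c [(v, False), (v, True)] = ?c []"
      by (rule equiv_class_eq[OF equiv_word_rel])
    then have "?c [(v, False)] \<otimes>\<^bsub>raag \<Gamma>\<^esub> raag_gen \<Gamma> v = \<one>\<^bsub>raag \<Gamma>\<^esub>"
      using presented_group_mult[of "[(v, False)]" "pverts \<Gamma>" "[(v, True)]" "raag_relations \<Gamma>"] v(1)
      by (simp add: raag_def raag_gen_def) (simp add: presented_group_def)
    then have "inv\<^bsub>raag \<Gamma>\<^esub> raag_gen \<Gamma> v = ?c [(v, False)]"
      by (rule inv_equality) (use v(1) in \<open>auto simp: carrier_raag raag_gen_def\<close>)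
    then show ?thesis using generate.inv[OF gen, of "raag \<Gamma>"] False by (simp add: parabolic_def)
  qed
qed

text \<open>
  Induction along a word. The factor \<open>h\<close> is a generator or its inverse, of which only the
  membership in all parabolic subgroups that involve the generator is recorded.
\<close>

lemma raag_induct [consumes 1, case_names one mult]:
  assumes "g \<in> carrier (raag \<Gamma>)" and one: "P \<one>\<^bsub>raag \<Gamma>\<^esub>"
    and mult: "\<And>g h v. g \<in> carrier (raag \<Gamma>) \<Longrightarrow> P g \<Longrightarrow> v \<in> pverts \<Gamma> \<Longrightarrow>
      (\<And>U. v \<in> U \<Longrightarrow> h \<in> parabolic \<Gamma> U) \<Longrightarrow> P (g \<otimes>\<^bsub>raag \<Gamma>\<^esub> h)"
  shows "P g"
proof -
  let ?c = "\<lambda>w. word_rel (pverts \<Gamma>) (raag_relations \<Gamma>) `` {w}"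
  have "P (?c w)" if "w \<in> words (pverts \<Gamma>)" for w
    using that
  proof (induction w rule: rev_induct)
    case Nil
    then show ?case using one by (simp add: raag_def presented_group_def)
  next
    case (snoc l w)
    obtain v b where l: "l = (v, b)" by fastforce
    then have w: "w \<in> words (pverts \<Gamma>)" "v \<in> pverts \<Gamma>" using snoc.prems by auto
    have "?c w \<otimes>\<^bsub>raag \<Gamma>\<^esub> ?c [l] = ?c (w @ [l])"
      unfolding raag_def by (rule presented_group_mult) (use w l in auto)
    moreover have "P (?c w \<otimes>\<^bsub>raag \<Gamma>\<^esub> ?c [l])"
      using w snoc.IH raag_letter_in_parabolic l by (intro mult[of _ v]) (auto simp: carrier_raag)
    ultimately show ?case by simp
  qed
  then show ?thesis using assms(1) by (auto simp: carrier_raag)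
qed

lemma l_coset_mult_subgroup:
  assumes "group G" "subgroup H G" "g \<in> carrier G" "h \<in> H"
  shows "(g \<otimes>\<^bsub>G\<^esub> h) <#\<^bsub>G\<^esub> H = g <#\<^bsub>G\<^esub> H"
proof -
  interpret group G by fact
  have "h \<in> carrier G" using assms(2,4) subgroup.mem_carrier by fast
  then have "(g \<otimes>\<^bsub>G\<^esub> h) <#\<^bsub>G\<^esub> H = g <#\<^bsub>G\<^esub> (h <#\<^bsub>G\<^esub> H)"
    using lcos_m_assoc[of H g h] assms subgroup.subset by blast
  then show ?thesis using coset_join3[OF \<open>h \<in> carrier G\<close> assms(2,4)] by simp
qed

lemma subset_raag_nbhd:
  assumes "P \<subseteq> carrier (raag \<Gamma>)" "0 \<le> r"
  shows "P \<subseteq> nbhd (carrier (raag \<Gamma>)) (raag_metric \<Gamma>) r P"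
proof
  fix x assume x: "x \<in> P"
  interpret group "raag \<Gamma>" by (rule group_raag)
  have "word_length (raag \<Gamma>) S \<one>\<^bsub>raag \<Gamma>\<^esub> = 0" for S
    unfolding word_length_def by (rule Least_eq_0) simp
  then have "raag_metric \<Gamma> x x = 0"
    using x assms(1) by (auto simp: raag_metric_def word_metric_def)
  moreover have "bdd_below (raag_metric \<Gamma> x ` P)"
    by (rule bdd_belowI[of _ 0]) (auto simp: raag_metric_def word_metric_def)
  ultimately have "(INF a\<in>P. raag_metric \<Gamma> x a) \<le> 0" using cINF_lower[of _ P x] x by metis
  then show "x \<in> nbhd (carrier (raag \<Gamma>)) (raag_metric \<Gamma>) r P"
    using x assms by (auto simp: nbhd_def)
qed

text \<open>The step relation asks only its target to be in \<open>\<A>\<close>; the starting set is in \<open>\<A>\<close> separately,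
  so that chains without any step are covered.\<close>

lemma thickI:
  assumes "\<And>x y. x \<in> E \<Longrightarrow> y \<in> E \<Longrightarrow> \<exists>A A'. x \<in> A \<and> A \<in> \<A> \<and> y \<in> A' \<and>
    (A, A') \<in> {(A, A'). A' \<in> \<A> \<and> (\<exists>B\<in>\<B>. B \<subseteq> A \<inter> A')}\<^sup>*"
  shows "thick \<A> \<B> E"
  unfolding thick_def
proof (intro ballI)
  let ?R = "{(A, A'). A' \<in> \<A> \<and> (\<exists>B\<in>\<B>. B \<subseteq> A \<inter> A')}"
  fix x y assume "x \<in> E" "y \<in> E"
  then obtain A A' where A: "x \<in> A" "A \<in> \<A>" "y \<in> A'" and "(A, A') \<in> ?R\<^sup>*"
    using assms by blast
  then obtain m where "(A, A') \<in> ?R ^^ m" using rtrancl_imp_relpow by blast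
  then obtain f where f: "f 0 = A" "f m = A'" "\<And>i. i < m \<Longrightarrow> (f i, f (Suc i)) \<in> ?R"
    unfolding relpow_fun_conv by blast
  have mem: "f i \<in> \<A>" if "i \<le> m" for i
  proof (cases i)
    case 0
    then show ?thesis using f A by simp
  next
    case (Suc j)
    then show ?thesis using f(3)[of j] that by simp
  qed
  have link: "\<exists>B\<in>\<B>. B \<subseteq> f (i - 1) \<inter> f i" if "1 \<le> i" "i < Suc m" for i
    using f(3)[of "i - 1"] that by simp
  show "\<exists>n A. 1 \<le> n \<and> (\<forall>i\<in>{1..n}. A i \<in> \<A>) \<and> x \<in> A 1 \<and> y \<in> A n \<and>
      (\<forall>i::nat. 1 \<le> i \<and> i < n \<longrightarrow> (\<exists>B\<in>\<B>. B \<subseteq> A i \<inter> A (i + 1)))"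
    using mem link f A by (intro exI[of _ "Suc m"] exI[of _ "\<lambda>i. f (i - 1)"]) auto
qed

theorem theorem6p7:
  fixes \<Gamma> :: "'v pair_pre_digraph"
    and r :: real
    and \<A> \<B> :: "'v word set set set"
  assumes "pair_graph \<Gamma>"
    and "triangle_free \<Gamma>"
    and "unpinched \<Gamma>"
    and "r = real (card (pverts \<Gamma>))"
    and "\<A> = {nbhd (carrier (raag \<Gamma>)) (raag_metric \<Gamma>) r P | P C.
               induced_cycle \<Gamma> C \<and> P \<in> lcosets\<^bsub>raag \<Gamma>\<^esub> (parabolic \<Gamma> C)}"
    and "\<B> = {P | P a b. a \<in> pverts \<Gamma> \<and> b \<in> pverts \<Gamma> \<and> a \<noteq> b \<and> (a, b) \<notin> parcs \<Gamma> \<and>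
               P \<in> lcosets\<^bsub>raag \<Gamma>\<^esub> (parabolic \<Gamma> {a, b})}"
  shows "thick \<A> \<B> (carrier (raag \<Gamma>))"
proof (rule thickI)
  interpret pair_graph \<Gamma> by (rule assms(1))
  interpret unpinched_triangle_free_graph \<Gamma>
    by unfold_locales (rule assms)+
  interpret A: group "raag \<Gamma>" by (rule group_raag)
  define N where "N g C = nbhd (carrier (raag \<Gamma>)) (raag_metric \<Gamma>) r (g <#\<^bsub>raag \<Gamma>\<^esub> parabolic \<Gamma> C)" for g C
  let ?R = "{(A, A'). A' \<in> \<A> \<and> (\<exists>B\<in>\<B>. B \<subseteq> A \<inter> A')}"
  obtain c where c: "\<And>v. v \<in> pverts \<Gamma> \<Longrightarrow> induced_cycle \<Gamma> (c v) \<and> v \<in> c v"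
    and linked: "\<And>v w. v \<in> pverts \<Gamma> \<Longrightarrow> w \<in> pverts \<Gamma> \<Longrightarrow> (c v, c w) \<in> cycle_link\<^sup>*"
    using linked_cycles_cover by blast
  obtain v0 where v0: "v0 \<in> pverts \<Gamma>" using conn_nonempty[OF conn_verts] by blast
  have cycV: "C \<subseteq> pverts \<Gamma>" if "induced_cycle \<Gamma> C" for C
    using that by (simp add: induced_cycle_def)
  have NA: "N g C \<in> \<A>" if "g \<in> carrier (raag \<Gamma>)" "induced_cycle \<Gamma> C" for g C
    using that unfolding assms(5) N_def LCOSETS_def by blast
  have sub: "g <#\<^bsub>raag \<Gamma>\<^esub> parabolic \<Gamma> C \<subseteq> N g C"
    if "g \<in> carrier (raag \<Gamma>)" "C \<subseteq> pverts \<Gamma>" for g C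
    unfolding N_def
    by (rule subset_raag_nbhd)
      (use that assms(4) A.l_coset_subset_G[OF subgroup.subset[OF parabolic_subgroup]] in simp_all)
  have self: "g \<in> N g C" if "g \<in> carrier (raag \<Gamma>)" "C \<subseteq> pverts \<Gamma>" for g C
    using sub[OF that] A.lcos_self[OF that(1) parabolic_subgroup[OF that(2)]] by blast
  have link: "(N g C, N g C') \<in> ?R"
    if g: "g \<in> carrier (raag \<Gamma>)" and CC': "(C, C') \<in> cycle_link" for g C C'
  proof -
    obtain a d where ad: "nonadj a d" "{a, d} \<subseteq> C \<inter> C'" and cyc: "induced_cycle \<Gamma> C" "induced_cycle \<Gamma> C'"
      using CC' by (auto simp: cycle_link_def)
    let ?B = "g <#\<^bsub>raag \<Gamma>\<^esub> parabolic \<Gamma> {a, d}"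
    have B: "?B \<in> \<B>"
    proof -
      have "a \<in> pverts \<Gamma>" "d \<in> pverts \<Gamma>" "a \<noteq> d" "(a, d) \<notin> parcs \<Gamma>"
        using ad cycV[OF cyc(1)] by (auto simp: nonadj_def)
      moreover have "?B \<in> lcosets\<^bsub>raag \<Gamma>\<^esub> parabolic \<Gamma> {a, d}" using g by (auto simp: LCOSETS_def)
      ultimately show ?thesis unfolding assms(6) by blast
    qed
    have BN: "?B \<subseteq> N g K" if K: "{a, d} \<subseteq> K" "induced_cycle \<Gamma> K" for K
    proof -
      have "?B \<subseteq> g <#\<^bsub>raag \<Gamma>\<^esub> parabolic \<Gamma> K"
        unfolding l_coset_def by (rule UN_mono[OF parabolic_mono[OF K(1)] subset_refl])
      then show ?thesis using sub[OF g cycV[OF K(2)]] by (rule order_trans)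
    qed
    have "?B \<subseteq> N g C \<inter> N g C'" using BN[OF _ cyc(1)] BN[OF _ cyc(2)] ad(2) by simp
    then show ?thesis using NA[OF g cyc(2)] B by blast
  qed
  have chain: "(N g C, N g C') \<in> ?R\<^sup>*"
    if g: "g \<in> carrier (raag \<Gamma>)" and CC': "(C, C') \<in> cycle_link\<^sup>*" for g C C'
    using CC'
  proof induction
    case (step C1 C2)
    then show ?case using link[OF g step(2)] by (meson rtrancl_into_rtrancl)
  qed simp
  have reach: "(N x (c v0), N (x \<otimes>\<^bsub>raag \<Gamma>\<^esub> g) (c v0)) \<in> ?R\<^sup>*"
    if "g \<in> carrier (raag \<Gamma>)" and x: "x \<in> carrier (raag \<Gamma>)" for x g
    using that(1)
  proof (induction g rule: raag_induct)
    case one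
    then show ?case using x by simp
  next
    case (mult g h v)
    have v: "v \<in> pverts \<Gamma>" using mult by blast
    have cv: "induced_cycle \<Gamma> (c v)" "v \<in> c v" using c[OF v] by auto
    have h: "h \<in> parabolic \<Gamma> (c v)" using mult cv by blast
    have sg: "subgroup (parabolic \<Gamma> (c v)) (raag \<Gamma>)" by (rule parabolic_subgroup[OF cycV[OF cv(1)]])
    have hG: "h \<in> carrier (raag \<Gamma>)" using subgroup.mem_carrier[OF sg h] .
    have xg: "x \<otimes>\<^bsub>raag \<Gamma>\<^esub> g \<in> carrier (raag \<Gamma>)" using x mult by simp
    let ?y = "x \<otimes>\<^bsub>raag \<Gamma>\<^esub> (g \<otimes>\<^bsub>raag \<Gamma>\<^esub> h)"
    have y: "?y = x \<otimes>\<^bsub>raag \<Gamma>\<^esub> g \<otimes>\<^bsub>raag \<Gamma>\<^esub> h" using x mult hG by (simp add: A.m_assoc)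
    then have yG: "?y \<in> carrier (raag \<Gamma>)" using xg hG by simp
    \<comment> \<open>The letter \<open>h\<close> lies in the parabolic subgroup of the cycle \<open>c v\<close>, so moving to this cycle
      at \<open>x \<otimes> g\<close> already reaches \<open>x \<otimes> g \<otimes> h\<close>.\<close>
    have same: "N (x \<otimes>\<^bsub>raag \<Gamma>\<^esub> g) (c v) = N ?y (c v)"
      unfolding N_def y l_coset_mult_subgroup[OF group_raag sg xg h] ..
    have "(N (x \<otimes>\<^bsub>raag \<Gamma>\<^esub> g) (c v0), N ?y (c v)) \<in> ?R\<^sup>*"
      using chain[OF xg linked[OF v0 v]] unfolding same .
    moreover have "(N ?y (c v), N ?y (c v0)) \<in> ?R\<^sup>*"
      by (rule chain[OF yG linked[OF v v0]])
    ultimately show ?case using mult.IH by (meson rtrancl_trans)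
  qed
  fix x y assume x: "x \<in> carrier (raag \<Gamma>)" and y: "y \<in> carrier (raag \<Gamma>)"
  have co: "induced_cycle \<Gamma> (c v0)" using c[OF v0] by blast
  have "x \<otimes>\<^bsub>raag \<Gamma>\<^esub> (inv\<^bsub>raag \<Gamma>\<^esub> x \<otimes>\<^bsub>raag \<Gamma>\<^esub> y) = y"
    using x y by (simp add: A.m_assoc[symmetric])
  then have "(N x (c v0), N y (c v0)) \<in> ?R\<^sup>*"
    using reach[of "inv\<^bsub>raag \<Gamma>\<^esub> x \<otimes>\<^bsub>raag \<Gamma>\<^esub> y" x] x y by simp
  then show "\<exists>A A'. x \<in> A \<and> A \<in> \<A> \<and> y \<in> A' \<and> (A, A') \<in> ?R\<^sup>*"
    using self[OF x cycV[OF co]] self[OF y cycV[OF co]] NA[OF x co] by blast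
qed

end
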